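(* Let $(A,\Delta,\epsilon,\Phi,\mathcal R)$ be a quasi-triangular quasi-Hopf (super)algebra and let $F\in A\otimes A$ be a twistor. Put $$u=\sum S\big(Y_\nu\beta S(Z_\nu)\big)\,S(e^i)\,\alpha\, e_i\,X_\nu\,(-1)^{[e_i]+[X_\nu]},$$ $$u_F=\sum S\big(Y^F_\nu\beta_FS(Z^F_\nu)\big)\,S(e^t_F)\,\alpha_F\,e^F_t\,X^F_\nu\,(-1)^{[e^F_t]+[X^F_\nu]}.$$ Then $u_F=u$; that is, the $u$-operator is invariant under twisting.
   Context: A quasi-Hopf (super)algebra $(A,\Delta,\epsilon,\Phi)$ is a unital associative $\mathbb Z_2$-graded algebra $A$ over a field $K$ (the ungraded case being $A$ concentrated in degree $0$; $[a]\in\mathbb Z_2$ is the degree of a homogeneous $a$; sign formulas are stated for homogeneous elements and extended linearly), with grading-preserving algebra homomorphisms $\epsilon:A\to K$, $\Delta:A\to A\otimes A$, an invertible homogeneous $\Phi\in A\otimes A\otimes A$, a graded algebra anti-homomorphism $S:A\to A$ (grading preserving, $S(ab)=(-1)^{[a][b]}S(b)S(a)$) and homogeneous $\alpha,\beta\in A$. Tensor products are multiplied by $(a\otimes b)(a'\otimes b')=(-1)^{[b][a']}aa'\otimes bb'$. Write $\Phi=\sum_\nu X_\nu\otimes Y_\nu\otimes Z_\nu$, $\Phi^{-1}=\sum_\nu\bar X_\nu\otimes\bar Y_\nu\otimes\bar Z_\nu$, $\Delta(a)=\sum a_{(1)}\otimes a_{(2)}$ (homogeneous components). The axioms are, for all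 $a\in A$: $(1\otimes\Delta)\Delta(a)=\Phi^{-1}(\Delta\otimes1)\Delta(a)\Phi$; $(\Delta\otimes1\otimes1)\Phi\cdot(1\otimes1\otimes\Delta)\Phi=(\Phi\otimes1)\cdot(1\otimes\Delta\otimes1)\Phi\cdot(1\otimes\Phi)$; $(\epsilon\otimes1)\Delta=1=(1\otimes\epsilon)\Delta$; $(1\otimes\epsilon\otimes1)\Phi=1$; $\sum S(a_{(1)})\alpha a_{(2)}=\epsilon(a)\alpha$; $\sum a_{(1)}\beta S(a_{(2)})=\epsilon(a)\beta$; $\sum\bar X_\nu\beta S(\bar Y_\nu)\alpha\bar Z_\nu=1$; $\sum S(X_\nu)\alpha Y_\nu\beta S(Z_\nu)=1$. These imply that $\Phi,\alpha,\beta$ are even. Let $T(a\otimes b)=(-1)^{[a][b]}b\otimes a$ and $\Delta^T=T\cdot\Delta$. $A$ is quasi-triangular if there is an invertible homogeneous $\mathcal R\in A\otimes A$ (it is then even) with $\Delta^T(a)\mathcal R=\mathcal R\Delta(a)$ for all $a\in A$, $(\Delta\otimes1)\mathcal R=\Phi^{-1}_{231}\mathcal R_{13}\Phi_{132}\mathcal R_{23}\Phi^{-1}_{123}$ and $(1\otimes\Delta)\mathcal R=\Phi_{312}\mathcal R_{13}\Phi^{-1}_{213}\mathcal R_{12}\Phi_{123}$, where $\Phi_{123}=\Phi$, $\Phi_{132}=(1\otimes T)\Phi$, $\Phi_{312}=(T\otimes1)(1\otimes T)\Phi$, $\Phi^{-1}_{213}=(T\otimes1)\Phi^{-1}$, $\Phi^{-1}_{231}=(1\otimes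 T)(T\otimes1)\Phi^{-1}$, and $\mathcal R_{ij}$ is $\mathcal R$ placed in tensor positions $i,j$. Write $\mathcal R=\sum_ie_i\otimes e^i$. A twistor is an invertible homogeneous $F\in A\otimes A$ with $(\epsilon\otimes1)F=1=(1\otimes\epsilon)F$ (it is then even). Write $F=\sum_i f_i\otimes f^i$, $F^{-1}=\sum_i\bar f_i\otimes\bar f^i$. The twisted quasi-triangular quasi-Hopf (super)algebra structure on $A$ has the same $\epsilon$ and $S$, and $\Delta_F(a)=F\Delta(a)F^{-1}$, $\Phi_F=(F\otimes1)\,(\Delta\otimes1)F\cdot\Phi\cdot(1\otimes\Delta)F^{-1}\,(1\otimes F^{-1})$, $\alpha_F=\sum_iS(\bar f_i)\alpha\bar f^i$, $\beta_F=\sum_if_i\beta S(f^i)$, $\mathcal R_F=F^T\mathcal RF^{-1}$ with $F^T=T(F)$. Write $\Phi_F=\sum_\nu X^F_\nu\otimes Y^F_\nu\otimes Z^F_\nu$ and $\mathcal R_F=\sum_te^F_t\otimes e^t_F$. *)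

theory Defs
  imports Complex_Main "HOL-Library.Poly_Mapping" "HOL-Library.Z2"
begin

definition fscale :: "'k::field \<Rightarrow> ('x \<Rightarrow>\<^sub>0 'k) \<Rightarrow> ('x \<Rightarrow>\<^sub>0 'k)" where
  "fscale c p = Poly_Mapping.map ((*) c) p"

lemma lookup_fscale: "Poly_Mapping.lookup (fscale c p) x = c * Poly_Mapping.lookup p x"
  by (simp add: fscale_def map.rep_eq when_def)

interpretation formal: vector_space fscale
  by unfold_locales
    (auto intro!: poly_mapping_eqI simp: lookup_fscale lookup_add algebra_simps)

definition lin_ext :: "('x \<Rightarrow> ('y \<Rightarrow>\<^sub>0 'k)) \<Rightarrow> ('x \<Rightarrow>\<^sub>0 'k::field) \<Rightarrow> ('y \<Rightarrow>\<^sub>0 'k)" where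
  "lin_ext f p = (\<Sum>x\<in>Poly_Mapping.keys p. fscale (Poly_Mapping.lookup p x) (f x))"

definition words :: "nat \<Rightarrow> ('a list \<Rightarrow>\<^sub>0 'k::zero) set" where
  "words n = {p. \<forall>xs\<in>Poly_Mapping.keys p. length xs = n}"

definition parity_sign :: "bit \<Rightarrow> 'k::ring_1" where
  "parity_sign d = (if d = 0 then 1 else - 1)"

text \<open>A type of candidates: the tensors proper are the cosets in \<open>tensors n\<close> below.\<close>

type_synonym ('k, 'a) tensor = "('a list \<Rightarrow>\<^sub>0 'k) set"

record (overloaded) ('k, 'a) quasi_hopf_data =
  comult :: "'a \<Rightarrow> ('k::field, 'a) tensor"
  counit :: "'a \<Rightarrow> 'k"
  coassociator :: "('k, 'a) tensor"
  antipode :: "'a \<Rightarrow> 'a"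
  alpha :: 'a
  beta :: 'a
  rmatrix :: "('k, 'a) tensor"

text \<open>The ungraded case is \<open>\<A> 0 = UNIV\<close>, \<open>\<A> 1 = {0}\<close>.\<close>

locale graded_algebra = vector_space scale
  for scale :: "'k::field \<Rightarrow> 'a::ring_1 \<Rightarrow> 'a" +
  fixes \<A> :: "bit \<Rightarrow> 'a set"
  assumes scale_mult_left: "scale c a * b = scale c (a * b)"
    and scale_mult_right: "a * scale c b = scale c (a * b)"
    and grade_subspace: "subspace (\<A> d)"
    and grade_span: "\<exists>x\<in>\<A> 0. \<exists>y\<in>\<A> 1. a = x + y"
    and grade_direct: "\<A> 0 \<inter> \<A> 1 = {0}"
    and grade_mult: "x \<in> \<A> d \<Longrightarrow> y \<in> \<A> e \<Longrightarrow> x * y \<in> \<A> (d + e)"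
    and grade_one: "1 \<in> \<A> 0"
begin

definition component :: "bit \<Rightarrow> 'a \<Rightarrow> 'a" where
  "component d a = (THE x. x \<in> \<A> d \<and> a - x \<in> \<A> (d + 1))"

text \<open>
  The \<open>n\<close>-th tensor power of the algebra is the space of formal sums of words of length \<open>n\<close>
  modulo the multilinearity relations; its elements are the cosets \<open>coset n p\<close>, and the word
  \<open>[a, b, c]\<close> stands for the pure tensor of \<open>a\<close>, \<open>b\<close> and \<open>c\<close>. The power for \<open>n = 0\<close> is the
  ground field and the one for \<open>n = 1\<close> is the algebra itself.
\<close>

definition relators :: "nat \<Rightarrow> ('a list \<Rightarrow>\<^sub>0 'k) set" where
  "relators n =
     {Poly_Mapping.single (xs @ [a + b] @ ys) 1
        - Poly_Mapping.single (xs @ [a] @ ys) 1 - Poly_Mapping.single (xs @ [b] @ ys) 1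
      | xs a b ys. length xs + 1 + length ys = n} \<union>
     {Poly_Mapping.single (xs @ [scale c a] @ ys) 1
        - fscale c (Poly_Mapping.single (xs @ [a] @ ys) 1)
      | xs c a ys. length xs + 1 + length ys = n}"

definition coset :: "nat \<Rightarrow> ('a list \<Rightarrow>\<^sub>0 'k) \<Rightarrow> ('k, 'a) tensor" where
  "coset n p = {q \<in> words n. q - p \<in> formal.span (relators n)}"

definition tensors :: "nat \<Rightarrow> ('k, 'a) tensor set" where
  "tensors n = coset n ` words n"

definition tensors_deg :: "nat \<Rightarrow> bit \<Rightarrow> ('k, 'a) tensor set" where
  "tensors_deg n d = coset n ` {p. \<forall>xs\<in>Poly_Mapping.keys p.
     \<exists>ds. length ds = n \<and> list_all2 (\<lambda>x e. x \<in> \<A> e) xs ds \<and> sum_list ds = d}"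

definition pure_tensor :: "'a list \<Rightarrow> ('k, 'a) tensor" where
  "pure_tensor xs = coset (length xs) (Poly_Mapping.single xs 1)"

definition tone :: "nat \<Rightarrow> ('k, 'a) tensor" where
  "tone n = pure_tensor (replicate n 1)"

text \<open>
  Maps on tensor powers are given by their values on words. All of these are multilinear in the
  letters of the word (modulo the relations in the target), so nothing below depends on the
  representative chosen by \<open>rep\<close>.
\<close>

definition rep :: "('k, 'a) tensor \<Rightarrow> ('a list \<Rightarrow>\<^sub>0 'k)" where
  "rep X = (SOME p. p \<in> X)"

definition induced :: "nat \<Rightarrow> ('a list \<Rightarrow> ('a list \<Rightarrow>\<^sub>0 'k)) \<Rightarrow> ('k, 'a) tensor \<Rightarrow> ('k, 'a) tensor" where
  "induced n f X = coset n (lin_ext f (rep X))"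

definition contract :: "('a list \<Rightarrow> 'a) \<Rightarrow> ('k, 'a) tensor \<Rightarrow> 'a" where
  "contract f X =
     (\<Sum>xs\<in>Poly_Mapping.keys (rep X). scale (Poly_Mapping.lookup (rep X) xs) (f xs))"

definition tadd :: "nat \<Rightarrow> ('k, 'a) tensor \<Rightarrow> ('k, 'a) tensor \<Rightarrow> ('k, 'a) tensor" where
  "tadd n X Y = coset n (rep X + rep Y)"

definition tscale :: "nat \<Rightarrow> 'k \<Rightarrow> ('k, 'a) tensor \<Rightarrow> ('k, 'a) tensor" where
  "tscale n c X = coset n (fscale c (rep X))"

text \<open>
  Product of words of homogeneous letters of degrees \<open>ds\<close> and \<open>es\<close>: moving the \<open>j\<close>-th letter of
  the second word past the \<open>i\<close>-th letter of the first, for all \<open>j < i\<close>, costs the sign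
  \<open>(-1)^(ds ! i * es ! j)\<close>. General words are split into homogeneous components.
\<close>

definition word_mult :: "nat \<Rightarrow> 'a list \<Rightarrow> 'a list \<Rightarrow> ('a list \<Rightarrow>\<^sub>0 'k)" where
  "word_mult n xs ys =
     (\<Sum>ds | length ds = n. \<Sum>es | length es = n.
        Poly_Mapping.single (map2 (*) (map2 component ds xs) (map2 component es ys))
          (parity_sign (\<Sum>i<n. \<Sum>j<i. ds ! i * es ! j)))"

definition tmult :: "('k, 'a) tensor \<Rightarrow> nat \<Rightarrow> ('k, 'a) tensor \<Rightarrow> ('k, 'a) tensor"
    ("(_ \<odot>\<^bsub>_\<^esub> _)" [70, 0, 71] 70) where
  "X \<odot>\<^bsub>n\<^esub> Y = induced n (\<lambda>xs. lin_ext (word_mult n xs) (rep Y)) X"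

definition is_tinverse :: "nat \<Rightarrow> ('k, 'a) tensor \<Rightarrow> ('k, 'a) tensor \<Rightarrow> bool" where
  "is_tinverse n X Y \<longleftrightarrow> Y \<in> tensors n \<and> X \<odot>\<^bsub>n\<^esub> Y = tone n \<and> Y \<odot>\<^bsub>n\<^esub> X = tone n"

definition tinvertible :: "nat \<Rightarrow> ('k, 'a) tensor \<Rightarrow> bool" where
  "tinvertible n X \<longleftrightarrow> X \<in> tensors n \<and> (\<exists>Y. is_tinverse n X Y)"

definition tinv :: "nat \<Rightarrow> ('k, 'a) tensor \<Rightarrow> ('k, 'a) tensor" where
  "tinv n X = (THE Y. is_tinverse n X Y)"

definition homogeneous :: "nat \<Rightarrow> ('k, 'a) tensor \<Rightarrow> bool" where
  "homogeneous n X \<longleftrightarrow> (\<exists>d. X \<in> tensors_deg n d)"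

text \<open>
  The next four maps act at position \<open>i\<close>, counted from \<open>0\<close>, of tensors in the \<open>n\<close>-th power.
  Thus \<open>swap 3 1\<close> is \<open>1 \<otimes> T\<close>; \<open>insert_one 2 i\<close> for \<open>i = 0, 1, 2\<close> maps \<open>R\<close> to \<open>R\<^sub>2\<^sub>3\<close>, \<open>R\<^sub>1\<^sub>3\<close>,
  \<open>R\<^sub>1\<^sub>2\<close>; \<open>comult_at H 2 1\<close> is \<open>1 \<otimes> \<Delta>\<close>; and \<open>counit_at H 2 0\<close> is \<open>\<epsilon> \<otimes> 1\<close>, where
  the scalar produced by \<open>\<epsilon>\<close> is multiplied into the remaining word.
\<close>

definition swap :: "nat \<Rightarrow> nat \<Rightarrow> ('k, 'a) tensor \<Rightarrow> ('k, 'a) tensor" where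
  "swap n i = induced n (\<lambda>xs. \<Sum>d\<in>{0, 1}. \<Sum>e\<in>{0, 1}.
     Poly_Mapping.single
       (take i xs @ [component e (xs ! (i + 1)), component d (xs ! i)] @ drop (i + 2) xs)
       (parity_sign (d * e)))"

definition insert_one :: "nat \<Rightarrow> nat \<Rightarrow> ('k, 'a) tensor \<Rightarrow> ('k, 'a) tensor" where
  "insert_one n i =
     induced (n + 1) (\<lambda>xs. Poly_Mapping.single (take i xs @ [1] @ drop i xs) 1)"

definition comult_at ::
    "('k, 'a) quasi_hopf_data \<Rightarrow> nat \<Rightarrow> nat \<Rightarrow> ('k, 'a) tensor \<Rightarrow> ('k, 'a) tensor" where
  "comult_at H n i = induced (n + 1) (\<lambda>xs.
     lin_ext (\<lambda>ys. Poly_Mapping.single (take i xs @ ys @ drop (i + 1) xs) 1)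
       (rep (comult H (xs ! i))))"

definition counit_at ::
    "('k, 'a) quasi_hopf_data \<Rightarrow> nat \<Rightarrow> nat \<Rightarrow> ('k, 'a) tensor \<Rightarrow> ('k, 'a) tensor" where
  "counit_at H n i = induced (n - 1) (\<lambda>xs.
     Poly_Mapping.single (take i xs @ drop (i + 1) xs) (counit H (xs ! i)))"

definition twistor :: "('k, 'a) quasi_hopf_data \<Rightarrow> ('k, 'a) tensor \<Rightarrow> bool" where
  "twistor H F \<longleftrightarrow> tinvertible 2 F \<and> homogeneous 2 F
     \<and> counit_at H 2 0 F = tone 1 \<and> counit_at H 2 1 F = tone 1"

definition twist ::
    "('k, 'a) tensor \<Rightarrow> ('k, 'a) quasi_hopf_data \<Rightarrow> ('k, 'a) quasi_hopf_data" where
  "twist F H =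
     \<lparr> comult = (\<lambda>a. F \<odot>\<^bsub>2\<^esub> comult H a \<odot>\<^bsub>2\<^esub> tinv 2 F),
       counit = counit H,
       coassociator =
         insert_one 2 2 F \<odot>\<^bsub>3\<^esub> comult_at H 2 0 F \<odot>\<^bsub>3\<^esub> coassociator H
           \<odot>\<^bsub>3\<^esub> comult_at H 2 1 (tinv 2 F) \<odot>\<^bsub>3\<^esub> insert_one 2 0 (tinv 2 F),
       antipode = antipode H,
       alpha = contract (\<lambda>f. antipode H (f ! 0) * alpha H * f ! 1) (tinv 2 F),
       beta = contract (\<lambda>f. f ! 0 * beta H * antipode H (f ! 1)) F,
       rmatrix = swap 2 0 F \<odot>\<^bsub>2\<^esub> rmatrix H \<odot>\<^bsub>2\<^esub> tinv 2 F \<rparr>"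

text \<open>Here \<open>w = [X, Y, Z]\<close> runs over \<open>\<Phi>\<close> and \<open>r = [e\<^sub>i, e\<^sup>i]\<close> over \<open>R\<close>.\<close>

definition u_operator :: "('k, 'a) quasi_hopf_data \<Rightarrow> 'a" where
  "u_operator H =
     contract (\<lambda>w. contract (\<lambda>r. \<Sum>d\<in>{0, 1}. \<Sum>e\<in>{0, 1}.
         scale (parity_sign (d + e))
           (antipode H (w ! 1 * beta H * antipode H (w ! 2)) * antipode H (r ! 1)
             * alpha H * component d (r ! 0) * component e (w ! 0)))
       (rmatrix H)) (coassociator H)"

end

locale quasi_hopf_superalgebra = graded_algebra scale \<A>
  for scale :: "'k::field \<Rightarrow> 'a::ring_1 \<Rightarrow> 'a" and \<A> :: "bit \<Rightarrow> 'a set" +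
  fixes H :: "('k, 'a) quasi_hopf_data"
  assumes counit_linear: "Vector_Spaces.linear scale (*) (counit H)"
    and counit_mult: "counit H (a * b) = counit H a * counit H b"
    and counit_one: "counit H 1 = 1"
    and counit_odd: "a \<in> \<A> 1 \<Longrightarrow> counit H a = 0"
    and comult_closed: "comult H a \<in> tensors 2"
    and comult_add: "comult H (a + b) = tadd 2 (comult H a) (comult H b)"
    and comult_scale: "comult H (scale c a) = tscale 2 c (comult H a)"
    and comult_mult: "comult H (a * b) = comult H a \<odot>\<^bsub>2\<^esub> comult H b"
    and comult_one: "comult H 1 = tone 2"
    and comult_grade: "a \<in> \<A> d \<Longrightarrow> comult H a \<in> tensors_deg 2 d"
    and antipode_linear: "Vector_Spaces.linear scale scale (antipode H)"
    and antipode_mult: "a \<in> \<A> d \<Longrightarrow> b \<in> \<A> e \<Longrightarrow>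
      antipode H (a * b) = scale (parity_sign (d * e)) (antipode H b * antipode H a)"
    and antipode_one: "antipode H 1 = 1"
    and antipode_grade: "a \<in> \<A> d \<Longrightarrow> antipode H a \<in> \<A> d"
    and coassociator_invertible: "tinvertible 3 (coassociator H)"
    and coassociator_homogeneous: "homogeneous 3 (coassociator H)"
    and alpha_homogeneous: "\<exists>d. alpha H \<in> \<A> d"
    and beta_homogeneous: "\<exists>d. beta H \<in> \<A> d"
    and quasi_coassociative:
      "comult_at H 2 1 (comult H a) =
         tinv 3 (coassociator H) \<odot>\<^bsub>3\<^esub> comult_at H 2 0 (comult H a) \<odot>\<^bsub>3\<^esub> coassociator H"
    and pentagon:
      "comult_at H 3 0 (coassociator H) \<odot>\<^bsub>4\<^esub> comult_at H 3 2 (coassociator H) =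
         insert_one 3 3 (coassociator H) \<odot>\<^bsub>4\<^esub> comult_at H 3 1 (coassociator H)
           \<odot>\<^bsub>4\<^esub> insert_one 3 0 (coassociator H)"
    and counit_left: "counit_at H 2 0 (comult H a) = pure_tensor [a]"
    and counit_right: "counit_at H 2 1 (comult H a) = pure_tensor [a]"
    and counit_coassociator: "counit_at H 3 1 (coassociator H) = tone 2"
    and antipode_alpha:
      "contract (\<lambda>x. antipode H (x ! 0) * alpha H * x ! 1) (comult H a)
         = scale (counit H a) (alpha H)"
    and antipode_beta:
      "contract (\<lambda>x. x ! 0 * beta H * antipode H (x ! 1)) (comult H a)
         = scale (counit H a) (beta H)"
    and antipode_coassociator_inv:
      "contract (\<lambda>w. w ! 0 * beta H * antipode H (w ! 1) * alpha H * w ! 2)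
         (tinv 3 (coassociator H)) = 1"
    and antipode_coassociator:
      "contract (\<lambda>w. antipode H (w ! 0) * alpha H * w ! 1 * beta H * antipode H (w ! 2))
         (coassociator H) = 1"

locale quasi_triangular_quasi_hopf_superalgebra = quasi_hopf_superalgebra scale \<A> H
  for scale :: "'k::field \<Rightarrow> 'a::ring_1 \<Rightarrow> 'a" and \<A> :: "bit \<Rightarrow> 'a set"
    and H :: "('k, 'a) quasi_hopf_data" +
  assumes rmatrix_invertible: "tinvertible 2 (rmatrix H)"
    and rmatrix_homogeneous: "homogeneous 2 (rmatrix H)"
    and rmatrix_comult:
      "swap 2 0 (comult H a) \<odot>\<^bsub>2\<^esub> rmatrix H = rmatrix H \<odot>\<^bsub>2\<^esub> comult H a"
    and hexagon_left:
      "comult_at H 2 0 (rmatrix H) =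
         swap 3 1 (swap 3 0 (tinv 3 (coassociator H)))
           \<odot>\<^bsub>3\<^esub> insert_one 2 1 (rmatrix H)
           \<odot>\<^bsub>3\<^esub> swap 3 1 (coassociator H)
           \<odot>\<^bsub>3\<^esub> insert_one 2 0 (rmatrix H)
           \<odot>\<^bsub>3\<^esub> tinv 3 (coassociator H)"
    and hexagon_right:
      "comult_at H 2 1 (rmatrix H) =
         swap 3 0 (swap 3 1 (coassociator H))
           \<odot>\<^bsub>3\<^esub> insert_one 2 1 (rmatrix H)
           \<odot>\<^bsub>3\<^esub> swap 3 0 (tinv 3 (coassociator H))
           \<odot>\<^bsub>3\<^esub> insert_one 2 2 (rmatrix H)
           \<odot>\<^bsub>3\<^esub> coassociator H"

end

theory Submission
  imports Defs
begin

text \<open>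
  Write \<open>R = \<Sum> e\<^sub>i \<otimes> e\<^sup>i\<close>, \<open>F = \<Sum> f\<^sub>j \<otimes> f\<^sup>j\<close>, \<open>F\<^sup>-\<^sup>1 = \<Sum> g\<^sub>j \<otimes> g\<^sup>j\<close> and, up to signs,
  \<open>\<gamma> = \<Sum> S(e\<^sup>i) \<alpha> e\<^sub>i\<close>, so that \<open>u = \<Sum> S(Y \<beta> S(Z)) \<gamma> X\<close>. The whole argument is a
  cancellation of \<open>F\<close> against its inverse inside such sandwiches.

  The alternating sum \<open>\<Sum> S(t\<^sup>j) x t\<^sub>j\<close> over a product of tensors nests: the sum over the right
  factor has the sum over the left factor as its middle term. Hence the factor \<open>F\<^sup>T\<close> of the twisted
  R-matrix cancels the inverse twistor inside \<open>\<alpha>\<^sub>F\<close>, and the twisted middle term is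
  \<open>\<gamma>\<^sub>F = \<Sum> S(g\<^sup>j) \<gamma> g\<^sub>j\<close> (\<open>koszul_tmult\<close>, \<open>koszul_swap\<close>, \<open>alpha_form_tmult\<close>). In
  \<open>Y\<^sub>F \<beta>\<^sub>F S(Z\<^sub>F)\<close> the rightmost factor \<open>1 \<otimes> F\<^sup>-\<^sup>1\<close> of the twisted coassociator turns \<open>\<beta>\<^sub>F\<close> back
  into \<open>\<beta>\<close> (\<open>u_form_right_insert\<close>), and then \<open>(1 \<otimes> \<Delta>) F\<^sup>-\<^sup>1\<close> disappears by the antipode axiom for
  \<open>\<beta>\<close> and the counit condition on \<open>F\<close> (\<open>u_form_right_comult\<close>). On the left, \<open>F \<otimes> 1\<close> turns \<open>\<gamma>\<^sub>F\<close>
  back into \<open>\<gamma>\<close>, and \<open>(\<Delta> \<otimes> 1) F\<close> disappears because \<open>\<Sum> S(a\<^sub>(\<^sub>2\<^sub>)) \<gamma> a\<^sub>(\<^sub>1\<^sub>) = \<epsilon>(a) \<gamma>\<close>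
  (\<open>u_form_left\<close>). That identity, \<open>gamma_comult\<close>, is where the R-matrix enters: rewriting
  \<open>R \<Delta>(a)\<close> as \<open>\<Delta>\<^sup>T(a) R\<close> brings the two legs of \<open>\<Delta>(a)\<close> next to \<open>\<alpha>\<close> in the order of the antipode
  axiom.

  Tensors are cosets of formal sums of words, and they are handled through the values that
  multilinear forms take on them. Multilinear forms separate tensors (\<open>tensor_eqI\<close>), every
  operation on tensors has a pullback on forms (\<open>contract_tmult\<close> and its analogues), and two
  multilinear forms agree as soon as they agree on words with homogeneous letters. Each step above
  is thereby an identity between signed products of homogeneous elements, decided by cases on
  the degrees.

  The signs cancel only because \<open>F\<close>, \<open>F\<^sup>-\<^sup>1\<close>, \<open>R\<close>, \<open>\<Phi>\<close> and \<open>\<beta>\<close> are even. For the homogeneous ones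
  this follows from the counit, which kills odd elements but takes a nonzero value on a suitable
  contraction of each (\<open>invertible_homogeneous_even\<close>, \<open>coassociator_even\<close>, \<open>beta_even\<close>); the inverse
  of an even tensor is even by uniqueness of inverses (\<open>concentrated_tinv\<close>).
\<close>

section \<open>Linear maps and homogeneous components\<close>

context graded_algebra
begin

abbreviation linear_map :: "('a \<Rightarrow> 'a) \<Rightarrow> bool" where
  "linear_map f \<equiv> Vector_Spaces.linear scale scale f"

lemma linear_mapI:
  assumes "\<And>x y. f (x + y) = f x + f y" "\<And>c x. f (scale c x) = scale c (f x)"
  shows "linear_map f"
  using assms by unfold_locales auto

lemma linear_mapD:
  assumes "linear_map f"
  shows "f (x + y) = f x + f y" "f (scale c x) = scale c (f x)" "f 0 = 0"
    "f (x - y) = f x - f y" "f (- x) = - f x" "f (sum g I) = (\<Sum>i\<in>I. f (g i))"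
proof -
  interpret f: Vector_Spaces.linear scale scale f by fact
  show "f (x + y) = f x + f y" "f (scale c x) = scale c (f x)" "f 0 = 0"
    "f (x - y) = f x - f y" "f (- x) = - f x" "f (sum g I) = (\<Sum>i\<in>I. f (g i))"
    by (rule f.add f.scale f.zero f.diff f.neg f.sum)+
qed

lemma linear_map_intros:
  "linear_map (\<lambda>x. x)"
  "linear_map (\<lambda>x. 0)"
  "linear_map f \<Longrightarrow> linear_map (\<lambda>x. f x * b)"
  "linear_map f \<Longrightarrow> linear_map (\<lambda>x. b * f x)"
  "linear_map f \<Longrightarrow> linear_map g \<Longrightarrow> linear_map (\<lambda>x. f x + g x)"
  "linear_map f \<Longrightarrow> linear_map (\<lambda>x. scale c (f x))"
  "(\<And>i. i \<in> I \<Longrightarrow> linear_map (F i)) \<Longrightarrow> linear_map (\<lambda>x. \<Sum>i\<in>I. F i x)"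
proof -
  show "linear_map f \<Longrightarrow> linear_map (\<lambda>x. f x * b)"
    by (rule linear_mapI) (simp_all add: linear_mapD distrib_right scale_mult_left)
  show "linear_map f \<Longrightarrow> linear_map (\<lambda>x. b * f x)"
    by (rule linear_mapI) (simp_all add: linear_mapD distrib_left scale_mult_right)
  show "(\<And>i. i \<in> I \<Longrightarrow> linear_map (F i)) \<Longrightarrow> linear_map (\<lambda>x. \<Sum>i\<in>I. F i x)"
    by (rule linear_mapI) (simp_all add: linear_mapD sum.distrib scale_sum_right)
qed (auto intro!: linear_mapI simp: linear_mapD scale_right_distrib mult.commute)

lemma linear_map_comp: "linear_map f \<Longrightarrow> linear_map g \<Longrightarrow> linear_map (\<lambda>x. f (g x))"
  by (rule linear_mapI) (simp_all add: linear_mapD)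

lemma grade_closed:
  "0 \<in> \<A> d" "x \<in> \<A> d \<Longrightarrow> y \<in> \<A> d \<Longrightarrow> x + y \<in> \<A> d" "x \<in> \<A> d \<Longrightarrow> scale c x \<in> \<A> d"
  "x \<in> \<A> d \<Longrightarrow> y \<in> \<A> d \<Longrightarrow> x - y \<in> \<A> d"
  using grade_subspace[of d] by (auto simp: subspace_0 subspace_add subspace_scale subspace_diff)

lemma grade_disjoint: "x \<in> \<A> d \<Longrightarrow> x \<in> \<A> (d + 1) \<Longrightarrow> x = 0"
  using grade_direct by (cases d) auto

text \<open>
  Identifies the definite description in the definition of \<open>component\<close>: the two grades meet only
  in \<open>0\<close>, so a splitting into homogeneous parts is unique.
\<close>

lemma component_unique:
  assumes "x \<in> \<A> d" "a - x \<in> \<A> (d + 1)"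
  shows "component d a = x"
  unfolding component_def
proof (rule the_equality)
  fix y assume y: "y \<in> \<A> d \<and> a - y \<in> \<A> (d + 1)"
  have "y - x \<in> \<A> d" using y assms grade_closed by auto
  moreover have "y - x = (a - x) - (a - y)" by simp
  then have "y - x \<in> \<A> (d + 1)" using y assms grade_closed(4) by metis
  ultimately show "y = x" using grade_disjoint by fastforce
qed (use assms in auto)

lemma component_grades: "component d a \<in> \<A> d" "a - component d a \<in> \<A> (d + 1)"
proof -
  obtain x y where xy: "x \<in> \<A> 0" "y \<in> \<A> 1" "a = x + y"
    using grade_span by blast
  have "component d a = (if d = 0 then x else y)"
    by (rule component_unique) (use xy in \<open>auto simp: algebra_simps\<close>)
  then show "component d a \<in> \<A> d" "a - component d a \<in> \<A> (d + 1)"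
    using xy by (cases d; auto)+
qed

lemma component_hom: "x \<in> \<A> d \<Longrightarrow> component e x = (if e = d then x else 0)"
  by (rule component_unique) (cases d; cases e; auto simp: grade_closed)+

lemma component_sum: "component 0 a + component 1 a = a"
proof -
  have "component 1 a = a - component 0 a"
    using component_grades[where d = 0 and a = a] by (intro component_unique) auto
  then show ?thesis by simp
qed

lemma linear_component: "linear_map (component d)"
proof (rule linear_mapI)
  fix x y c
  have "x + y - (component d x + component d y) = (x - component d x) + (y - component d y)"
    by simp
  then show "component d (x + y) = component d x + component d y"
    using grade_closed(2)[OF component_grades(2)[where d = d and a = x] component_grades(2)[where d = d and a = y]]
    by (intro component_unique) (simp_all only: grade_closed component_grades)
  have "scale c x - scale c (component d x) = scale c (x - component d x)"
    by (simp add: scale_right_diff_distrib)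
  then show "component d (scale c x) = scale c (component d x)"
    using grade_closed(3)[OF component_grades(2)[where d = d and a = x], of c]
    by (intro component_unique) (simp_all only: grade_closed component_grades)
qed

section \<open>Formal sums and multilinear forms\<close>

text \<open>
  The linear extension of \<open>f\<close> to formal sums, with values in the algebra. A contraction is the
  extension evaluated at a representative, but \<open>lin_eval\<close> itself involves no choice.
\<close>

definition lin_eval :: "('x \<Rightarrow> 'a) \<Rightarrow> ('x \<Rightarrow>\<^sub>0 'k) \<Rightarrow> 'a" where
  "lin_eval f p = (\<Sum>x\<in>Poly_Mapping.keys p. scale (Poly_Mapping.lookup p x) (f x))"

lemma contract_eq_lin_eval: "contract f X = lin_eval f (rep X)"
  by (simp add: contract_def lin_eval_def)

lemma lin_eval_superset:
  "finite I \<Longrightarrow> Poly_Mapping.keys p \<subseteq> I \<Longrightarrow> lin_eval f p = (\<Sum>x\<in>I. scale (Poly_Mapping.lookup p x) (f x))"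
  unfolding lin_eval_def by (rule sum.mono_neutral_left) (auto simp: in_keys_iff)

lemma linear_lin_eval: "Vector_Spaces.linear fscale scale (lin_eval f)"
proof -
  have "lin_eval f (p + q) = lin_eval f p + lin_eval f q" for p q
  proof -
    let ?I = "Poly_Mapping.keys p \<union> Poly_Mapping.keys q"
    have "Poly_Mapping.keys (p + q) \<subseteq> ?I" by (rule Poly_Mapping.keys_add)
    then show ?thesis
      by (simp add: lin_eval_superset[of ?I] lookup_add scale_left_distrib sum.distrib)
  qed
  moreover have "lin_eval f (fscale c p) = scale c (lin_eval f p)" for c p
  proof -
    have "Poly_Mapping.keys (fscale c p) \<subseteq> Poly_Mapping.keys p"
      by (auto simp: in_keys_iff lookup_fscale)
    then show ?thesis
      by (simp add: lin_eval_superset[of "Poly_Mapping.keys p"] lookup_fscale scale_sum_right)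
  qed
  ultimately show ?thesis by unfold_locales auto
qed

lemma lin_eval_simps:
  "lin_eval f (p + q) = lin_eval f p + lin_eval f q"
  "lin_eval f (p - q) = lin_eval f p - lin_eval f q"
  "lin_eval f (fscale c p) = scale c (lin_eval f p)"
  "lin_eval f 0 = 0"
  "lin_eval f (sum P I) = (\<Sum>i\<in>I. lin_eval f (P i))"
  "lin_eval f (Poly_Mapping.single x c) = scale c (f x)"
proof -
  interpret e: Vector_Spaces.linear fscale scale "lin_eval f" by (rule linear_lin_eval)
  show "lin_eval f (p + q) = lin_eval f p + lin_eval f q"
    "lin_eval f (p - q) = lin_eval f p - lin_eval f q"
    "lin_eval f (fscale c p) = scale c (lin_eval f p)"
    "lin_eval f 0 = 0"
    "lin_eval f (sum P I) = (\<Sum>i\<in>I. lin_eval f (P i))"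
    by (rule e.add e.diff e.scale e.zero e.sum)+
  show "lin_eval f (Poly_Mapping.single x c) = scale c (f x)"
    by (cases "c = 0") (simp_all add: lin_eval_def)
qed

lemma lin_eval_lin_ext: "lin_eval f (lin_ext g p) = lin_eval (\<lambda>x. lin_eval f (g x)) p"
  by (simp add: lin_ext_def lin_eval_simps) (simp add: lin_eval_def)

lemma lin_eval_cong: "(\<And>x. x \<in> Poly_Mapping.keys p \<Longrightarrow> f x = g x) \<Longrightarrow> lin_eval f p = lin_eval g p"
  by (simp add: lin_eval_def)

lemma lin_eval_linear: "linear_map f \<Longrightarrow> f (lin_eval g p) = lin_eval (\<lambda>x. f (g x)) p"
  by (simp add: lin_eval_def linear_mapD)

lemma formal_expand: "p = lin_ext (\<lambda>x. Poly_Mapping.single x 1) p"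
proof (rule poly_mapping_eqI)
  fix y
  have "Poly_Mapping.lookup (lin_ext (\<lambda>x. Poly_Mapping.single x 1) p) y =
      (\<Sum>x\<in>Poly_Mapping.keys p. if x = y then Poly_Mapping.lookup p x else 0)"
    unfolding lin_ext_def lookup_sum lookup_fscale lookup_single
    by (intro sum.cong) (auto simp: when_def)
  also have "\<dots> = Poly_Mapping.lookup p y"
    by (simp add: in_keys_iff)
  finally show "Poly_Mapping.lookup p y = Poly_Mapping.lookup (lin_ext (\<lambda>x. Poly_Mapping.single x 1) p) y"
    by simp
qed

lemma words_closed:
  "0 \<in> words n" "p \<in> words n \<Longrightarrow> q \<in> words n \<Longrightarrow> p + q \<in> words n"
  "p \<in> words n \<Longrightarrow> fscale c p \<in> words n"
  "length xs = n \<Longrightarrow> Poly_Mapping.single xs c \<in> words n"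
proof -
  show "p \<in> words n \<Longrightarrow> q \<in> words n \<Longrightarrow> p + q \<in> words n"
    using Poly_Mapping.keys_add[of p q] by (auto simp: words_def)
  show "p \<in> words n \<Longrightarrow> fscale c p \<in> words n"
    by (auto simp: words_def in_keys_iff lookup_fscale)
qed (auto simp: words_def)

lemma words_sum:
  fixes P :: "'i \<Rightarrow> ('a list \<Rightarrow>\<^sub>0 'k)"
  shows "(\<And>i. i \<in> I \<Longrightarrow> P i \<in> words n) \<Longrightarrow> sum P I \<in> words n"
  by (induction I rule: infinite_finite_induct) (auto intro: words_closed)

lemma words_lin_ext:
  fixes g :: "'x \<Rightarrow> ('a list \<Rightarrow>\<^sub>0 'k)"
  shows "(\<And>x. x \<in> Poly_Mapping.keys p \<Longrightarrow> g x \<in> words n) \<Longrightarrow> lin_ext g p \<in> words n"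
  unfolding lin_ext_def by (intro words_sum words_closed)

lemma words_keysD: "p \<in> words n \<Longrightarrow> x \<in> Poly_Mapping.keys p \<Longrightarrow> length x = n"
  by (auto simp: words_def)

lemma coset_self: "p \<in> words n \<Longrightarrow> p \<in> coset n p"
  by (simp add: coset_def formal.span_zero)

lemma rep_coset:
  assumes "p \<in> words n"
  shows "rep (coset n p) \<in> words n" "rep (coset n p) - p \<in> formal.span (relators n)"
proof -
  have "rep (coset n p) \<in> coset n p"
    unfolding rep_def using coset_self[OF assms] by (rule someI)
  then show "rep (coset n p) \<in> words n" "rep (coset n p) - p \<in> formal.span (relators n)"
    by (auto simp: coset_def)
qed

lemma rep_words: "X \<in> tensors n \<Longrightarrow> rep X \<in> words n"
  by (auto simp: tensors_def rep_coset)

lemma coset_in_tensors: "p \<in> words n \<Longrightarrow> coset n p \<in> tensors n"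
  by (simp add: tensors_def)

lemma coset_eqI: "p - q \<in> formal.span (relators n) \<Longrightarrow> coset n p = coset n q"
proof -
  assume pq: "p - q \<in> formal.span (relators n)"
  then have qp: "q - p \<in> formal.span (relators n)"
    using formal.span_neg[OF pq] by simp
  have "r - p \<in> formal.span (relators n) \<longleftrightarrow> r - q \<in> formal.span (relators n)" for r
    using formal.span_add[OF pq, of "r - p"] formal.span_add[OF qp, of "r - q"] 
    by (auto simp: algebra_simps)
  then show ?thesis by (auto simp: coset_def)
qed

text \<open>
  Stated with an update of one letter, so that multilinearity of a form written in terms of
  \<open>w ! 0\<close>, \<open>w ! 1\<close>, ... reduces to linearity in each letter.
\<close>

definition multilinear :: "nat \<Rightarrow> ('a list \<Rightarrow> 'a) \<Rightarrow> bool" where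
  "multilinear n h \<longleftrightarrow> (\<forall>xs i. length xs = n \<longrightarrow> i < n \<longrightarrow> linear_map (\<lambda>a. h (xs[i := a])))"

lemma multilinear_intros:
  "(\<And>i. i \<in> I \<Longrightarrow> multilinear n (F i)) \<Longrightarrow> multilinear n (\<lambda>w. \<Sum>i\<in>I. F i w)"
  "multilinear n h \<Longrightarrow> multilinear n (\<lambda>w. scale c (h w))"
  unfolding multilinear_def by (auto intro!: linear_map_intros)

text \<open>
  The relators are the differences that a multilinear form sends to \<open>0\<close>; this is why contractions
  with multilinear forms are independent of representatives.
\<close>

lemma multilinear_relators:
  assumes h: "multilinear n h" and p: "p \<in> formal.span (relators n)"
  shows "lin_eval h p = 0"
proof -
  interpret e: Vector_Spaces.linear fscale scale "lin_eval h" by (rule linear_lin_eval)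
  have upd: "(xs @ [0] @ ys)[length xs := a] = xs @ [a] @ ys" for xs ys and a :: 'a
    by simp
  have lin: "linear_map (\<lambda>a. h (xs @ [a] @ ys))" if "length xs + 1 + length ys = n" for xs ys
    using h[unfolded multilinear_def, rule_format, of "xs @ [0] @ ys" "length xs"] that
    by (simp only: upd) simp
  have "relators n \<subseteq> {p. lin_eval h p = 0}"
    unfolding relators_def
    by (auto simp: lin_eval_simps linear_mapD[OF lin, simplified])
  then have "formal.span (relators n) \<subseteq> {p. lin_eval h p = 0}"
    by (rule formal.span_minimal) (rule e.subspace_kernel)
  then show ?thesis using p by auto
qed

lemma contract_coset:
  assumes "multilinear n h" "p \<in> words n"
  shows "contract h (coset n p) = lin_eval h p"
  using multilinear_relators[OF assms(1) rep_coset(2)[OF assms(2)]]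
  by (simp add: contract_eq_lin_eval lin_eval_simps)

text \<open>
  Only the form \<open>h\<close> on the target has to be multilinear: both sides evaluate the same chosen
  representative of \<open>X\<close>, so \<open>f\<close> need not respect the relators.
\<close>

lemma contract_induced:
  assumes h: "multilinear n h" and X: "X \<in> tensors m"
    and f: "\<And>xs. length xs = m \<Longrightarrow> f xs \<in> words n"
  shows "contract h (induced n f X) = contract (\<lambda>xs. lin_eval h (f xs)) X"
  unfolding induced_def
  by (subst contract_coset)
    (auto intro!: h words_lin_ext f words_keysD[OF rep_words[OF X]]
      simp: lin_eval_lin_ext contract_eq_lin_eval)

lemma induced_in_tensors:
  assumes "X \<in> tensors m" and "\<And>xs. length xs = m \<Longrightarrow> f xs \<in> words n"
  shows "induced n f X \<in> tensors n"
  unfolding induced_def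
  by (intro coset_in_tensors words_lin_ext assms words_keysD[OF rep_words[OF assms(1)]])

text \<open>
  Multilinear forms separate tensors. If the difference of two representatives lies outside the
  span of the relators, some linear map on formal sums kills the span and sends the difference
  to \<open>1\<close>; its restriction to words is a multilinear form with different values on the two tensors.
\<close>

lemma tensor_eqI:
  assumes X: "X \<in> tensors n" and Y: "Y \<in> tensors n"
    and eq: "\<And>h. multilinear n h \<Longrightarrow> contract h X = contract h Y"
  shows "X = Y"
proof -
  obtain p q where p: "p \<in> words n" "X = coset n p" and q: "q \<in> words n" "Y = coset n q"
    using X Y by (auto simp: tensors_def)
  have "p - q \<in> formal.span (relators n)"
  proof (rule ccontr)
    assume v: "p - q \<notin> formal.span (relators n)"
    obtain B where B: "B \<subseteq> relators n" "formal.independent B" "relators n \<subseteq> formal.span B"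
      by (rule formal.maximal_independent_subset)
    have "formal.span B = formal.span (relators n)"
      using B by (metis formal.span_mono formal.span_span subset_antisym)
    then have ind: "formal.independent (insert (p - q) B)"
      using v B(2) by (simp add: formal.independent_insertI)
    interpret vp: vector_space_pair fscale scale ..
    obtain \<phi> where \<phi>: "Vector_Spaces.linear fscale scale \<phi>"
      "\<forall>x\<in>insert (p - q) B. \<phi> x = (if x = p - q then 1 else 0)"
      using vp.linear_independent_extend[OF ind, of "\<lambda>x. if x = p - q then 1 else 0"] by blast
    interpret \<phi>: Vector_Spaces.linear fscale scale \<phi> by (rule \<phi>(1))
    have "p - q \<notin> B" using v B(1) formal.span_superset by blast
    then have "B \<subseteq> {x. \<phi> x = 0}" using \<phi>(2) by auto
    then have "formal.span B \<subseteq> {x. \<phi> x = 0}"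
      by (rule formal.span_minimal) (rule \<phi>.subspace_kernel)
    then have rel0: "\<phi> r = 0" if "r \<in> relators n" for r
      using that B(3) by auto
    define h where "h xs = \<phi> (Poly_Mapping.single xs 1)" for xs
    have ev: "lin_eval h r = \<phi> r" for r
    proof -
      have "\<phi> r = \<phi> (lin_ext (\<lambda>x. Poly_Mapping.single x 1) r)"
        using formal_expand[of r] by simp
      then show ?thesis
        by (simp add: lin_ext_def lin_eval_def h_def \<phi>.sum \<phi>.scale)
    qed
    have "multilinear n h"
      unfolding multilinear_def
    proof (intro allI impI linear_mapI)
      fix xs :: "'a list" and i and a b :: 'a and c :: 'k assume l: "length xs = n" "i < n"
      let ?s = "\<lambda>z. Poly_Mapping.single (take i xs @ [z] @ drop (Suc i) xs) (1::'k)"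
      have *: "xs[i := z] = take i xs @ [z] @ drop (Suc i) xs" for z
        using l by (simp add: upd_conv_take_nth_drop)
      have len: "length (take i xs) + 1 + length (drop (Suc i) xs) = n" using l by simp
      have "?s (a + b) - ?s a - ?s b \<in> relators n"
        unfolding relators_def using len by blast
      from rel0[OF this] show "h (xs[i := a + b]) = h (xs[i := a]) + h (xs[i := b])"
        by (simp only: * h_def \<phi>.diff) (simp add: algebra_simps)
      have "?s (scale c a) - fscale c (?s a) \<in> relators n"
        unfolding relators_def using len by blast
      from rel0[OF this] show "h (xs[i := scale c a]) = scale c (h (xs[i := a]))"
        by (simp only: * h_def \<phi>.diff \<phi>.scale) (simp add: algebra_simps)
    qed
    from eq[OF this] have "lin_eval h p = lin_eval h q"
      using p q \<open>multilinear n h\<close> by (simp add: contract_coset)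
    then have "\<phi> (p - q) = 0" by (simp add: ev \<phi>.diff)
    then show False using \<phi>(2) by simp
  qed
  then show ?thesis using p q coset_eqI by blast
qed

end

text \<open>
  These rules rewrite sums and products of degrees into bitwise operations; sign bookkeeping
  needs them in ring form.
\<close>

declare add_bit_eq_xor [simp del] mult_bit_eq_and [simp del]

context graded_algebra
begin

abbreviation hom_word :: "'a list \<Rightarrow> bit list \<Rightarrow> bool" where
  "hom_word xs ds \<equiv> list_all2 (\<lambda>x d. x \<in> \<A> d) xs ds"

lemma multilinear_contract:
  assumes "X \<in> tensors m" "\<And>x. length x = m \<Longrightarrow> multilinear n (\<lambda>w. f w x)"
  shows "multilinear n (\<lambda>w. contract (f w) X)"
  unfolding contract_eq_lin_eval lin_eval_def
  by (intro multilinear_intros assms(2) words_keysD[OF rep_words[OF assms(1)]])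

lemma linear_map_contract:
  assumes "X \<in> tensors m" "\<And>x. length x = m \<Longrightarrow> linear_map (\<lambda>w. f w x)"
  shows "linear_map (\<lambda>w. contract (f w) X)"
  unfolding contract_eq_lin_eval lin_eval_def
  by (intro linear_map_intros assms(2) words_keysD[OF rep_words[OF assms(1)]])

lemma contract_words_cong:
  assumes "X \<in> tensors n" "\<And>x. length x = n \<Longrightarrow> f x = g x"
  shows "contract f X = contract g X"
  unfolding contract_eq_lin_eval
  by (intro lin_eval_cong assms(2) words_keysD[OF rep_words[OF assms(1)]])

lemma linear_map_of_contract: "linear_map f \<Longrightarrow> f (contract g X) = contract (\<lambda>x. f (g x)) X"
  by (simp add: contract_eq_lin_eval lin_eval_linear)

lemma multilinear_zero_letter:
  assumes "multilinear n h" "length xs = n" "i < n" "xs ! i = 0"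
  shows "h xs = 0"
proof -
  have "h (xs[i := 0]) = 0"
    using assms linear_mapD(3) unfolding multilinear_def by blast
  then show ?thesis using assms(4) list_update_id[of xs i] by simp
qed

text \<open>
  Splitting the letters one at a time into homogeneous components reduces to homogeneous words;
  the induction is on the number \<open>j\<close> of initial letters that may be inhomogeneous.
\<close>

lemma multilinear_eq_on_homogeneous:
  assumes h: "multilinear n h" and k: "multilinear n k"
    and eq: "\<And>xs ds. length xs = n \<Longrightarrow> hom_word xs ds \<Longrightarrow> h xs = k xs"
    and len: "length xs = n"
  shows "h xs = k xs"
proof -
  have "\<forall>xs. length xs = n \<longrightarrow> (\<forall>i. j \<le> i \<longrightarrow> i < n \<longrightarrow> (\<exists>d. xs ! i \<in> \<A> d)) \<longrightarrow> h xs = k xs"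
    if "j \<le> n" for j
    using that
  proof (induction j)
    case 0
    show ?case
    proof (intro allI impI)
      fix xs assume l: "length xs = n" and hom: "\<forall>i. 0 \<le> i \<longrightarrow> i < n \<longrightarrow> (\<exists>d. xs ! i \<in> \<A> d)"
      then obtain d where "\<And>i. i < n \<Longrightarrow> xs ! i \<in> \<A> (d i)" by (metis le0)
      then have "hom_word xs (map d [0..<n])"
        using l by (auto simp: list_all2_conv_all_nth)
      then show "h xs = k xs" using eq l by blast
    qed
  next
    case (Suc j)
    show ?case
    proof (intro allI impI)
      fix xs assume l: "length xs = n" and hom: "\<forall>i. Suc j \<le> i \<longrightarrow> i < n \<longrightarrow> (\<exists>d. xs ! i \<in> \<A> d)"
      have split: "f xs = f (xs[j := component 0 (xs ! j)]) + f (xs[j := component 1 (xs ! j)])"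
        if "multilinear n f" for f
      proof -
        have "linear_map (\<lambda>a. f (xs[j := a]))"
          using that l Suc.prems unfolding multilinear_def by simp
        from linear_mapD(1)[OF this, of "component 0 (xs ! j)" "component 1 (xs ! j)"]
        show ?thesis by (simp add: component_sum)
      qed
      have "h (xs[j := component e (xs ! j)]) = k (xs[j := component e (xs ! j)])" for e
      proof -
        let ?ys = "xs[j := component e (xs ! j)]"
        have "\<exists>d. ?ys ! i \<in> \<A> d" if "j \<le> i" "i < n" for i
          using hom that l component_grades(1)[of e "xs ! j"]
          by (cases "i = j") auto
        then show ?thesis using Suc.IH Suc.prems l by auto
      qed
      then show "h xs = k xs" by (simp only: split[OF h] split[OF k])
    qed
  qed
  from this[of n] show ?thesis using len by auto
qed

text \<open>
  The tensor lies in the sum of the graded pieces whose total degrees belong to \<open>D\<close>, expressed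
  by what multilinear forms can see: only their values on homogeneous words of such degrees
  matter. Thus \<open>D = UNIV\<close> is no restriction and \<open>D = {0}\<close> means even.
\<close>

definition concentrated :: "nat \<Rightarrow> bit set \<Rightarrow> ('k, 'a) tensor \<Rightarrow> bool" where
  "concentrated n D X \<longleftrightarrow> X \<in> tensors n \<and>
     (\<forall>h k. multilinear n h \<longrightarrow> multilinear n k \<longrightarrow>
       (\<forall>xs ds. length xs = n \<longrightarrow> hom_word xs ds \<longrightarrow> sum_list ds \<in> D \<longrightarrow> h xs = k xs) \<longrightarrow>
       contract h X = contract k X)"

lemma concentratedD: "concentrated n D X \<Longrightarrow> X \<in> tensors n"
  by (simp add: concentrated_def)

lemma concentrated_cong:
  assumes "concentrated n D X" "multilinear n h" "multilinear n k"
    "\<And>xs ds. length xs = n \<Longrightarrow> hom_word xs ds \<Longrightarrow> sum_list ds \<in> D \<Longrightarrow> h xs = k xs"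
  shows "contract h X = contract k X"
  using assms unfolding concentrated_def by blast

lemma concentrated_UNIV: "X \<in> tensors n \<Longrightarrow> concentrated n UNIV X"
  unfolding concentrated_def
  using multilinear_eq_on_homogeneous[of n] contract_words_cong[of X n] by (metis UNIV_I)

lemma concentrated_deg:
  assumes "X \<in> tensors_deg n d"
  shows "concentrated n {d} X"
proof -
  obtain p where p: "X = coset n p"
    "\<forall>xs\<in>Poly_Mapping.keys p. \<exists>ds. length ds = n \<and> hom_word xs ds \<and> sum_list ds = d"
    using assms by (auto simp: tensors_deg_def)
  then have w: "p \<in> words n" by (force simp: words_def dest: list_all2_lengthD)
  show ?thesis
    unfolding concentrated_def
  proof (intro conjI allI impI)
    show "X \<in> tensors n" using p w coset_in_tensors by simp
    fix h k assume hk: "multilinear n h" "multilinear n k"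
      "\<forall>xs ds. length xs = n \<longrightarrow> hom_word xs ds \<longrightarrow> sum_list ds \<in> {d} \<longrightarrow> h xs = k xs"
    have "lin_eval h p = lin_eval k p"
      by (rule lin_eval_cong) (use hk(3) p(2) w words_keysD in blast)
    then show "contract h X = contract k X"
      using p w hk by (simp add: contract_coset)
  qed
qed

lemma contract_pure:
  "multilinear (length xs) h \<Longrightarrow> contract h (pure_tensor xs) = h xs"
  unfolding pure_tensor_def by (simp add: contract_coset words_closed lin_eval_simps)

lemma pure_in_tensors: "length xs = n \<Longrightarrow> pure_tensor xs \<in> tensors n"
  unfolding pure_tensor_def by (auto intro!: coset_in_tensors words_closed)

lemma tone_in_tensors: "tone n \<in> tensors n"
  unfolding tone_def by (simp add: pure_in_tensors)

lemma contract_tone: "multilinear n h \<Longrightarrow> contract h (tone n) = h (replicate n 1)"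
  unfolding tone_def by (simp add: contract_pure)

section \<open>The graded product and inverses\<close>

lemma finite_bit_lists: "finite {ds :: bit list. length ds = n}"
proof -
  have "UNIV = {0, 1 :: bit}" by (metis (full_types) UNIV_eq_I bit_not_one_iff insert_iff)
  then have "finite (UNIV :: bit set)" by (metis finite.simps)
  from finite_lists_length_eq[OF this, of n] show ?thesis by simp
qed

definition word_sign :: "nat \<Rightarrow> bit list \<Rightarrow> bit list \<Rightarrow> bit" where
  "word_sign n ds es = (\<Sum>i<n. \<Sum>j<i. ds ! i * es ! j)"

text \<open>
  The pullback of a form along multiplication: a form in two words, again multilinear in each.
\<close>

definition mult_form :: "nat \<Rightarrow> ('a list \<Rightarrow> 'a) \<Rightarrow> 'a list \<Rightarrow> 'a list \<Rightarrow> 'a" where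
  "mult_form n h xs ys = lin_eval h (word_mult n xs ys)"

lemma mult_form_expand:
  "mult_form n h xs ys = (\<Sum>ds | length ds = n. \<Sum>es | length es = n.
     scale (parity_sign (word_sign n ds es))
       (h (map2 (*) (map2 component ds xs) (map2 component es ys))))"
  by (simp add: mult_form_def word_mult_def lin_eval_simps word_sign_def)

lemma multilinear_component_words:
  assumes h: "multilinear n h" and "length ds = n"
  shows "multilinear n (\<lambda>xs. h (map2 component ds xs))"
  unfolding multilinear_def
proof (intro allI impI)
  fix xs :: "'a list" and i assume l: "length xs = n" "i < n"
  have "map2 component ds (xs[i := a]) = (map2 component ds xs)[i := component (ds ! i) a]" for a
    by (rule nth_equalityI) (use l assms in \<open>auto simp: nth_list_update\<close>)
  then show "linear_map (\<lambda>a. h (map2 component ds (xs[i := a])))"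
    using h l assms(2) linear_map_comp[OF _ linear_component, of "\<lambda>a. h ((map2 component ds xs)[i := a])"]
    unfolding multilinear_def by simp
qed

lemma multilinear_mult:
  assumes h: "multilinear n h" and "length ys = n"
  shows "multilinear n (\<lambda>xs. h (map2 (*) xs ys))" "multilinear n (\<lambda>xs. h (map2 (*) ys xs))"
proof -
  have *: "map2 (*) (xs[i := a]) ys = (map2 (*) xs ys)[i := a * ys ! i]"
    "map2 (*) ys (xs[i := a]) = (map2 (*) ys xs)[i := ys ! i * a]"
    if "length xs = n" "i < n" for xs i a
    by (rule nth_equalityI; use that assms in \<open>auto simp: nth_list_update\<close>)+
  have lin: "linear_map (\<lambda>a. h (zs[i := f a]))" if "linear_map f" "length zs = n" "i < n" for zs i f
    using linear_map_comp[OF _ that(1), of "\<lambda>a. h (zs[i := a])"] that h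
    unfolding multilinear_def by simp
  show "multilinear n (\<lambda>xs. h (map2 (*) xs ys))" "multilinear n (\<lambda>xs. h (map2 (*) ys xs))"
    using assms(2) unfolding multilinear_def
    by (auto simp: * intro!: lin linear_map_intros)
qed

lemma multilinear_mult_form:
  assumes h: "multilinear n h" and l: "length ys = n"
  shows "multilinear n (\<lambda>xs. mult_form n h xs ys)" "multilinear n (\<lambda>xs. mult_form n h ys xs)"
proof -
  have len: "length (map2 component es ys) = n" if "length es = n" for es
    using that l by simp
  show "multilinear n (\<lambda>xs. mult_form n h xs ys)" "multilinear n (\<lambda>xs. mult_form n h ys xs)"
    unfolding mult_form_expand
    by (intro multilinear_intros multilinear_mult[OF h len, THEN multilinear_component_words]; simp)+
qed

text \<open>
  Choosing the components of the letters according to their degrees keeps a homogeneous word; any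
  other choice produces a zero letter and is invisible to a multilinear form.
\<close>

lemma map2_component_hom:
  assumes "hom_word xs ds" "length es = length ds"
  shows "(es = ds \<and> map2 component es xs = xs) \<or> (\<exists>i<length ds. map2 component es xs ! i = 0)"
proof -
  have c: "map2 component es xs ! i = (if es ! i = ds ! i then xs ! i else 0)" if "i < length ds" for i
    using assms that by (auto simp: list_all2_conv_all_nth component_hom)
  show ?thesis
  proof (cases "es = ds")
    case True
    then have "map2 component es xs = xs"
      using c assms by (auto simp: list_all2_conv_all_nth intro!: nth_equalityI)
    then show ?thesis using True by simp
  next
    case False
    then obtain i where "i < length ds" "es ! i \<noteq> ds ! i"
      using assms(2) by (auto simp: list_eq_iff_nth_eq)
    then show ?thesis using c by auto
  qed
qed

lemma mult_form_hom:
  assumes h: "multilinear n h" and x: "hom_word xs ds" "length xs = n" and y: "hom_word ys es" "length ys = n"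
  shows "mult_form n h xs ys = scale (parity_sign (word_sign n ds es)) (h (map2 (*) xs ys))"
proof -
  have l: "length ds = n" "length es = n" using x y by (auto dest: list_all2_lengthD)
  let ?t = "scale (parity_sign (word_sign n ds es)) (h (map2 (*) xs ys))"
  have "scale (parity_sign (word_sign n ds' es'))
       (h (map2 (*) (map2 component ds' xs) (map2 component es' ys))) =
     (if ds' = ds then if es' = es then ?t else 0 else 0)"
    if l': "length ds' = n" "length es' = n" for ds' es'
  proof (cases "ds' = ds \<and> es' = es")
    case True
    then have "map2 component ds' xs = xs" "map2 component es' ys = ys"
      using x y l by (auto simp: list_all2_conv_all_nth component_hom intro!: nth_equalityI)
    then show ?thesis using True by simp
  next
    case False
    then obtain i where "i < n" "map2 component ds' xs ! i = 0 \<or> map2 component es' ys ! i = 0"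
      using map2_component_hom[OF x(1), of ds'] map2_component_hom[OF y(1), of es'] l l' by auto
    then have "h (map2 (*) (map2 component ds' xs) (map2 component es' ys)) = 0"
      using x y l' by (intro multilinear_zero_letter[OF h, of _ i]) auto
    then show ?thesis using False by auto
  qed
  then have "mult_form n h xs ys = (\<Sum>ds' | length ds' = n. \<Sum>es' | length es' = n.
      if ds' = ds then if es' = es then ?t else 0 else 0)"
    unfolding mult_form_expand by (intro sum.cong refl) simp
  also have "\<dots> = (\<Sum>ds' | length ds' = n. if ds' = ds then ?t else 0)"
    using l by (intro sum.cong refl) (simp add: finite_bit_lists)
  also have "\<dots> = ?t" using l by (simp add: finite_bit_lists)
  finally show ?thesis .
qed

lemma word_mult_words: "length xs = n \<Longrightarrow> length ys = n \<Longrightarrow> word_mult n xs ys \<in> words n"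
  unfolding word_mult_def by (intro words_sum words_closed) simp

lemma contract_tmult:
  assumes h: "multilinear n h" and X: "X \<in> tensors n" and Y: "Y \<in> tensors n"
  shows "contract h (X \<odot>\<^bsub>n\<^esub> Y) = contract (\<lambda>xs. contract (mult_form n h xs) Y) X"
proof -
  have w: "lin_ext (word_mult n xs) (rep Y) \<in> words n" if "length xs = n" for xs
    by (intro words_lin_ext word_mult_words that) (rule words_keysD[OF rep_words[OF Y]])
  have "contract h (X \<odot>\<^bsub>n\<^esub> Y) = contract (\<lambda>xs. lin_eval h (lin_ext (word_mult n xs) (rep Y))) X"
    unfolding tmult_def by (rule contract_induced[OF h X w])
  then show ?thesis
    by (simp add: lin_eval_lin_ext contract_eq_lin_eval mult_form_def[abs_def])
qed

lemma tmult_in_tensors: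
  assumes X: "X \<in> tensors n" and Y: "Y \<in> tensors n"
  shows "X \<odot>\<^bsub>n\<^esub> Y \<in> tensors n"
  unfolding tmult_def
  by (intro induced_in_tensors[OF X] words_lin_ext word_mult_words)
    (assumption, rule words_keysD[OF rep_words[OF Y]])

text \<open>
  To contract a product it suffices to know a form \<open>k\<close> in two words that
  agrees with the signed product on homogeneous words of the degrees that occur.
\<close>

lemma contract_tmult_concentrated:
  assumes X: "concentrated n D X" and Y: "concentrated n E Y" and h: "multilinear n h"
    and k1: "\<And>ys. length ys = n \<Longrightarrow> multilinear n (\<lambda>xs. k xs ys)"
    and k2: "\<And>xs. length xs = n \<Longrightarrow> multilinear n (k xs)"
    and eq: "\<And>xs ds ys es. length xs = n \<Longrightarrow> hom_word xs ds \<Longrightarrow> sum_list ds \<in> D \<Longrightarrow>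
      length ys = n \<Longrightarrow> hom_word ys es \<Longrightarrow> sum_list es \<in> E \<Longrightarrow>
      scale (parity_sign (word_sign n ds es)) (h (map2 (*) xs ys)) = k xs ys"
  shows "contract h (X \<odot>\<^bsub>n\<^esub> Y) = contract (\<lambda>xs. contract (k xs) Y) X"
proof -
  note XY = concentratedD[OF X] concentratedD[OF Y]
  have "contract h (X \<odot>\<^bsub>n\<^esub> Y) = contract (\<lambda>xs. contract (mult_form n h xs) Y) X"
    by (rule contract_tmult[OF h XY])
  also have "\<dots> = contract (\<lambda>xs. contract (k xs) Y) X"
  proof (rule concentrated_cong[OF X])
    fix xs ds assume x: "length xs = n" "hom_word xs ds" "sum_list ds \<in> D"
    show "contract (mult_form n h xs) Y = contract (k xs) Y"
      by (rule concentrated_cong[OF Y])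
        (use x eq in \<open>auto simp: mult_form_hom[OF h] multilinear_mult_form[OF h] k2\<close>)
  qed (intro multilinear_contract[OF XY(2)] multilinear_mult_form(1)[OF h] k1; assumption)+
  finally show ?thesis .
qed

lemma hom_word_mult:
  assumes "hom_word xs ds" "hom_word ys es" 
  shows "hom_word (map2 (*) xs ys) (map2 (+) ds es)"
  using assms by (auto simp: list_all2_conv_all_nth grade_mult)

text \<open>
  Bilinearity of the sign exponent in the degrees makes it a two-cocycle; this is what the signed
  product needs to be associative.
\<close>

lemma word_sign_cocycle:
  assumes "length ds = n" "length es = n" "length fs = n"
  shows "word_sign n ds es + word_sign n (map2 (+) ds es) fs =
    word_sign n es fs + word_sign n ds (map2 (+) es fs)"
proof -
  have "word_sign n (map2 (+) ds es) fs = word_sign n ds fs + word_sign n es fs"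
    using assms by (simp add: word_sign_def distrib_right flip: sum.distrib)
  moreover have "word_sign n ds (map2 (+) es fs) = word_sign n ds es + word_sign n ds fs"
    using assms by (simp add: word_sign_def distrib_left flip: sum.distrib)
  ultimately show ?thesis by simp
qed

lemma parity_sign_add: "parity_sign (d + e) = parity_sign d * (parity_sign e :: 'k)"
  by (cases d; cases e) (auto simp: parity_sign_def)

lemma tmult_assoc:
  assumes X: "X \<in> tensors n" and Y: "Y \<in> tensors n" and Z: "Z \<in> tensors n"
  shows "(X \<odot>\<^bsub>n\<^esub> Y) \<odot>\<^bsub>n\<^esub> Z = X \<odot>\<^bsub>n\<^esub> (Y \<odot>\<^bsub>n\<^esub> Z)"
proof (rule tensor_eqI)
  fix h assume h: "multilinear n h"
  note mf = multilinear_mult_form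
  have "contract h ((X \<odot>\<^bsub>n\<^esub> Y) \<odot>\<^bsub>n\<^esub> Z) = contract (\<lambda>ws. contract (mult_form n h ws) Z) (X \<odot>\<^bsub>n\<^esub> Y)"
    by (intro contract_tmult h tmult_in_tensors X Y Z)
  also have "\<dots> = contract (\<lambda>xs. contract (\<lambda>ys. contract (\<lambda>zs. mult_form n (mult_form n h xs) ys zs) Z) Y) X"
  proof (rule contract_tmult_concentrated[OF concentrated_UNIV[OF X] concentrated_UNIV[OF Y]])
    fix xs ds ys es assume x: "length xs = n" "hom_word xs ds" and y: "length ys = n" "hom_word ys es"
    have lin: "linear_map (scale c)" for c by (rule linear_map_intros) (rule linear_map_intros)
    have "contract (\<lambda>zs. scale (parity_sign (word_sign n ds es)) (mult_form n h (map2 (*) xs ys) zs)) Z =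
      contract (mult_form n (mult_form n h xs) ys) Z"
    proof (rule concentrated_cong[OF concentrated_UNIV[OF Z]])
      fix zs fs assume z: "length zs = n" "hom_word zs fs"
      have l: "length ds = n" "length es = n" "length fs = n"
        using x y z by (auto dest: list_all2_lengthD)
      have a: "map2 (*) (map2 (*) xs ys) zs = map2 (*) xs (map2 (*) ys zs)"
        by (rule nth_equalityI) (use x y z in \<open>auto simp: mult.assoc\<close>)
      show "scale (parity_sign (word_sign n ds es)) (mult_form n h (map2 (*) xs ys) zs) =
          mult_form n (mult_form n h xs) ys zs"
        using x y z
        by (simp add: mult_form_hom[OF h hom_word_mult[OF x(2) y(2)] _ z(2)]
          mult_form_hom[OF mf(2)[OF h x(1)] y(2) _ z(2)]
          mult_form_hom[OF h x(2) _ hom_word_mult[OF y(2) z(2)]] a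
          word_sign_cocycle[OF l] flip: parity_sign_add)
    qed (intro multilinear_intros mf h; simp add: x y)+
    then show "scale (parity_sign (word_sign n ds es)) (contract (mult_form n h (map2 (*) xs ys)) Z) =
      contract (mult_form n (mult_form n h xs) ys) Z"
      by (simp add: linear_map_of_contract[OF lin])
  next
    fix ys :: "'a list" assume y: "length ys = n"
    show "multilinear n (\<lambda>xs. contract (mult_form n (mult_form n h xs) ys) Z)"
    proof (rule multilinear_contract[OF Z])
      fix zs :: "'a list" assume "length zs = n"
      then show "multilinear n (\<lambda>xs. mult_form n (mult_form n h xs) ys zs)"
        using y unfolding mult_form_expand[of n "mult_form n h _"]
        by (intro multilinear_intros mf h) auto
    qed
  qed (intro multilinear_contract[OF Z] mf h; simp)+
  also have "\<dots> = contract (\<lambda>xs. contract (mult_form n h xs) (Y \<odot>\<^bsub>n\<^esub> Z)) X"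
    by (rule contract_words_cong[OF X]) (simp add: contract_tmult[OF mf(2)[OF h] Y Z])
  also have "\<dots> = contract h (X \<odot>\<^bsub>n\<^esub> (Y \<odot>\<^bsub>n\<^esub> Z))"
    by (intro contract_tmult[symmetric] h tmult_in_tensors X Y Z)
  finally show "contract h ((X \<odot>\<^bsub>n\<^esub> Y) \<odot>\<^bsub>n\<^esub> Z) = contract h (X \<odot>\<^bsub>n\<^esub> (Y \<odot>\<^bsub>n\<^esub> Z))" .
qed (intro tmult_in_tensors X Y Z)+

lemma hom_ones: "hom_word (replicate n 1) (replicate n 0)"
  by (simp add: list_all2_conv_all_nth grade_one)

lemma tmult_one:
  assumes X: "X \<in> tensors n"
  shows "tone n \<odot>\<^bsub>n\<^esub> X = X" "X \<odot>\<^bsub>n\<^esub> tone n = X"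
proof -
  note T = tone_in_tensors[of n] and o = hom_ones[of n]
  have s: "word_sign n (replicate n 0) ds = 0" "word_sign n ds (replicate n 0) = 0" for ds
    by (simp_all add: word_sign_def)
  have m: "map2 (*) (replicate n 1) xs = xs" "map2 (*) xs (replicate n 1) = xs" if "length xs = n" for xs :: "'a list"
    by (rule nth_equalityI; use that in simp)+
  show "tone n \<odot>\<^bsub>n\<^esub> X = X"
  proof (rule tensor_eqI)
    fix h assume h: "multilinear n h"
    have "contract h (tone n \<odot>\<^bsub>n\<^esub> X) = contract (\<lambda>xs. contract (mult_form n h xs) X) (tone n)"
      by (intro contract_tmult h X T)
    also have "\<dots> = contract (mult_form n h (replicate n 1)) X"
      by (intro contract_tone multilinear_contract[OF X] multilinear_mult_form h)
    also have "\<dots> = contract h X"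
      by (rule concentrated_cong[OF concentrated_UNIV[OF X]])
        (auto simp: mult_form_hom[OF h o] s m parity_sign_def intro!: multilinear_mult_form h)
    finally show "contract h (tone n \<odot>\<^bsub>n\<^esub> X) = contract h X" .
  qed (intro tmult_in_tensors X T)+
  show "X \<odot>\<^bsub>n\<^esub> tone n = X"
  proof (rule tensor_eqI)
    fix h assume h: "multilinear n h"
    have "contract h (X \<odot>\<^bsub>n\<^esub> tone n) = contract (\<lambda>xs. contract (mult_form n h xs) (tone n)) X"
      by (intro contract_tmult h X T)
    also have "\<dots> = contract (\<lambda>xs. mult_form n h xs (replicate n 1)) X"
      by (rule contract_words_cong[OF X]) (intro contract_tone multilinear_mult_form h)
    also have "\<dots> = contract h X"
      by (rule concentrated_cong[OF concentrated_UNIV[OF X]])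
        (auto simp: mult_form_hom[OF h _ _ o] s m parity_sign_def intro!: multilinear_mult_form h)
    finally show "contract h (X \<odot>\<^bsub>n\<^esub> tone n) = contract h X" .
  qed (intro tmult_in_tensors X T)+
qed

lemma right_inverse_eq_inverse:
  assumes "X \<in> tensors n" "is_tinverse n X Y" "Z \<in> tensors n" "X \<odot>\<^bsub>n\<^esub> Z = tone n"
  shows "Z = Y"
proof -
  have Y: "Y \<in> tensors n" "Y \<odot>\<^bsub>n\<^esub> X = tone n" using assms by (auto simp: is_tinverse_def)
  have "Z = (Y \<odot>\<^bsub>n\<^esub> X) \<odot>\<^bsub>n\<^esub> Z" using Y assms by (simp add: tmult_one)
  also have "\<dots> = Y" using tmult_assoc[OF Y(1) assms(1,3)] assms(4) Y by (simp add: tmult_one)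
  finally show ?thesis .
qed

lemma is_tinverse_tinv:
  assumes "tinvertible n X"
  shows "is_tinverse n X (tinv n X)"
proof -
  obtain Y where X: "X \<in> tensors n" and Y: "is_tinverse n X Y"
    using assms by (auto simp: tinvertible_def)
  show ?thesis unfolding tinv_def
    by (rule theI[of "is_tinverse n X" Y, OF Y]) (use right_inverse_eq_inverse[OF X Y] in \<open>auto simp: is_tinverse_def\<close>)
qed

text \<open>
  The form \<open>h\<close> restricted to even words: on a homogeneous word it is \<open>h\<close> or \<open>0\<close> according to the
  total degree.
\<close>

definition even_form :: "nat \<Rightarrow> ('a list \<Rightarrow> 'a) \<Rightarrow> 'a list \<Rightarrow> 'a" where
  "even_form n h xs = (\<Sum>ds | length ds = n \<and> sum_list ds = 0. h (map2 component ds xs))"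

lemma multilinear_even_form: "multilinear n h \<Longrightarrow> multilinear n (even_form n h)"
  unfolding even_form_def by (auto intro!: multilinear_intros multilinear_component_words)

lemma even_form_hom:
  assumes h: "multilinear n h" and x: "hom_word xs ds" "length xs = n"
  shows "even_form n h xs = (if sum_list ds = 0 then h xs else 0)"
proof -
  have l: "length ds = n" using x by (auto dest: list_all2_lengthD)
  have "h (map2 component es xs) = (if es = ds then h xs else 0)" if len: "length es = n" for es
  proof (cases "es = ds")
    case True
    then have "map2 component es xs = xs"
      using x l by (auto simp: list_all2_conv_all_nth component_hom intro!: nth_equalityI)
    then show ?thesis using True by simp
  next
    case False
    then obtain i where "i < n" "map2 component es xs ! i = 0"
      using map2_component_hom[OF x(1), of es] l len by auto
    then have "h (map2 component es xs) = 0"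
      using x len by (intro multilinear_zero_letter[OF h, of _ i]) auto
    then show ?thesis using False by auto
  qed
  then have "even_form n h xs = (\<Sum>es | length es = n \<and> sum_list es = 0. if es = ds then h xs else 0)"
    unfolding even_form_def by (intro sum.cong refl) simp
  also have "\<dots> = (if sum_list ds = 0 then h xs else 0)"
  proof -
    have "finite {es :: bit list. length es = n \<and> sum_list es = 0}"
      by (rule finite_subset[OF _ finite_bit_lists[of n]]) auto
    then show ?thesis using l by simp
  qed
  finally show ?thesis .
qed

definition even_part :: "nat \<Rightarrow> ('k, 'a) tensor \<Rightarrow> ('k, 'a) tensor" where
  "even_part n = induced n (\<lambda>xs. \<Sum>ds | length ds = n \<and> sum_list ds = 0.
     Poly_Mapping.single (map2 component ds xs) 1)"

lemma even_part:
  assumes X: "X \<in> tensors n"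
  shows "even_part n X \<in> tensors n"
    and "multilinear n h \<Longrightarrow> contract h (even_part n X) = contract (even_form n h) X"
proof -
  have w: "(\<Sum>ds | length ds = n \<and> sum_list ds = 0. Poly_Mapping.single (map2 component ds xs) (1::'k)) \<in> words n"
    if "length xs = n" for xs
    using that by (intro words_sum words_closed) auto
  show "even_part n X \<in> tensors n"
    unfolding even_part_def by (rule induced_in_tensors[OF X w])
  show "contract h (even_part n X) = contract (even_form n h) X" if "multilinear n h"
    using contract_induced[OF that X w]
    by (simp add: even_part_def lin_eval_simps even_form_def[abs_def])
qed

lemma concentrated_even_part:
  assumes X: "X \<in> tensors n"
  shows "concentrated n {0} (even_part n X)"
  unfolding concentrated_def
proof (intro conjI allI impI even_part[OF X])
  fix h k assume h: "multilinear n h" and k: "multilinear n k"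
    and eq: "\<forall>xs ds. length xs = n \<longrightarrow> hom_word xs ds \<longrightarrow> sum_list ds \<in> {0} \<longrightarrow> h xs = k xs"
  show "contract h (even_part n X) = contract k (even_part n X)"
    unfolding even_part(2)[OF X h] even_part(2)[OF X k]
    by (rule concentrated_cong[OF concentrated_UNIV[OF X]])
      (auto simp: eq even_form_hom[OF h] even_form_hom[OF k] intro!: multilinear_even_form h k)
qed

lemma sum_list_map2_add:
  "length ds = length es \<Longrightarrow> sum_list (map2 (+) ds es) = sum_list ds + sum_list (es :: bit list)"
  by (induction ds es rule: list_induct2) (auto simp: algebra_simps)

text \<open>
  The product of an even tensor with the even part of its inverse is the even part of \<open>1\<close>, that
  is \<open>1\<close>. So the even part of the inverse is an inverse too, and equals it by uniqueness.
\<close>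

lemma concentrated_tinv:
  assumes X: "concentrated n {0} X" and inv: "tinvertible n X"
  shows "concentrated n {0} (tinv n X)"
proof -
  let ?Y = "tinv n X"
  note XT = concentratedD[OF X]
  have Y: "?Y \<in> tensors n" "X \<odot>\<^bsub>n\<^esub> ?Y = tone n"
    using is_tinverse_tinv[OF inv] by (auto simp: is_tinverse_def)
  have "X \<odot>\<^bsub>n\<^esub> even_part n ?Y = tone n"
  proof (rule tensor_eqI)
    fix h assume h: "multilinear n h"
    note mf = multilinear_mult_form
    have "contract h (X \<odot>\<^bsub>n\<^esub> even_part n ?Y) = contract (\<lambda>xs. contract (mult_form n h xs) (even_part n ?Y)) X"
      by (intro contract_tmult h XT even_part Y)
    also have "\<dots> = contract (\<lambda>xs. contract (even_form n (mult_form n h xs)) ?Y) X"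
      by (rule contract_words_cong[OF XT]) (intro even_part(2) Y mf h)
    also have "\<dots> = contract (even_form n h) (X \<odot>\<^bsub>n\<^esub> ?Y)"
    proof (rule contract_tmult_concentrated[OF X concentrated_UNIV[OF Y(1)], symmetric])
      fix xs ds ys es assume x: "length xs = n" "hom_word xs ds" "sum_list ds \<in> {0}"
        and y: "length ys = n" "hom_word ys es"
      have "sum_list (map2 (+) ds es) = sum_list es"
        using x y by (subst sum_list_map2_add) (auto dest!: list_all2_lengthD)
      then show "scale (parity_sign (word_sign n ds es)) (even_form n h (map2 (*) xs ys)) =
        even_form n (mult_form n h xs) ys"
        using x y
        by (simp add: even_form_hom[OF h hom_word_mult[OF x(2) y(2)]]
           even_form_hom[OF mf(2)[OF h x(1)] y(2)] mult_form_hom[OF h x(2) _ y(2)])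
    next
      fix ys :: "'a list" assume "length ys = n"
      then show "multilinear n (\<lambda>xs. even_form n (mult_form n h xs) ys)"
        unfolding even_form_def by (intro multilinear_intros mf h) simp
    qed (intro multilinear_even_form mf h)+
    also have "\<dots> = contract h (tone n)"
      unfolding Y(2) contract_tone[OF h] contract_tone[OF multilinear_even_form[OF h]]
      by (simp add: even_form_hom[OF h hom_ones] sum_list_replicate)
    finally show "contract h (X \<odot>\<^bsub>n\<^esub> even_part n ?Y) = contract h (tone n)" .
  qed (intro tmult_in_tensors XT even_part Y tone_in_tensors)+
  then have "even_part n ?Y = ?Y"
    by (intro right_inverse_eq_inverse[OF XT is_tinverse_tinv[OF inv]] even_part Y)
  then show ?thesis using concentrated_even_part[OF Y(1)] by simp
qed

section \<open>Forms on the second and third tensor powers\<close>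

lemma multilinear2I:
  assumes "\<And>b. linear_map (\<lambda>a. h [a, b])" "\<And>a. linear_map (\<lambda>b. h [a, b])"
  shows "multilinear 2 h"
  unfolding multilinear_def
proof (intro allI impI)
  fix xs :: "'a list" and i :: nat assume "length xs = 2" "i < 2"
  then obtain a b where "xs = [a, b]" "i = 0 \<or> i = 1"
    by (auto simp: length_Suc_conv numeral_2_eq_2 less_Suc_eq)
  then show "linear_map (\<lambda>a. h (xs[i := a]))" using assms by auto
qed

lemma multilinear3I:
  assumes "\<And>b c. linear_map (\<lambda>a. h [a, b, c])" "\<And>a c. linear_map (\<lambda>b. h [a, b, c])"
    "\<And>a b. linear_map (\<lambda>c. h [a, b, c])"
  shows "multilinear 3 h"
  unfolding multilinear_def
proof (intro allI impI)
  fix xs :: "'a list" and i :: nat assume "length xs = 3" "i < 3"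
  then obtain a b c where "xs = [a, b, c]" "i = 0 \<or> i = 1 \<or> i = 2"
    by (auto simp: length_Suc_conv numeral_3_eq_3 less_Suc_eq)
  then show "linear_map (\<lambda>a. h (xs[i := a]))" using assms by auto
qed

lemma multilinear3D:
  assumes "multilinear 3 h"
  shows "linear_map (\<lambda>a. h [a, b, c])" "linear_map (\<lambda>b. h [a, b, c])" "linear_map (\<lambda>c. h [a, b, c])"
proof -
  have *: "linear_map (\<lambda>z. h ([a, b, c][i := z]))" if "i < 3" for i a b c
    using assms that unfolding multilinear_def by (simp del: list_update.simps)
  show "linear_map (\<lambda>a. h [a, b, c])" "linear_map (\<lambda>b. h [a, b, c])" "linear_map (\<lambda>c. h [a, b, c])"
    using *[of 0 a b c] *[of 1 a b c] *[of 2 a b c] by simp_all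
qed

lemma multilinear2D:
  assumes "multilinear 2 h"
  shows "linear_map (\<lambda>a. h [a, b])" "linear_map (\<lambda>b. h [a, b])"
proof -
  have *: "linear_map (\<lambda>z. h ([a, b][i := z]))" if "i < 2" for i a b
    using assms that unfolding multilinear_def by (simp del: list_update.simps)
  show "linear_map (\<lambda>a. h [a, b])" "linear_map (\<lambda>b. h [a, b])"
    using *[of 0 a b] *[of 1 a b] by simp_all
qed

lemma length_2E: "length xs = 2 \<Longrightarrow> (\<And>a b. xs = [a, b] \<Longrightarrow> P) \<Longrightarrow> P"
  by (auto simp: length_Suc_conv numeral_2_eq_2)

lemma hom_word2E:
  assumes "length xs = 2" "hom_word xs ds"
  obtains a b d e where "xs = [a, b]" "ds = [d, e]" "a \<in> \<A> d" "b \<in> \<A> e"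
  using assms by (auto simp: length_Suc_conv numeral_2_eq_2 list_all2_Cons1)

lemma hom_word3E:
  assumes "length xs = 3" "hom_word xs ds"
  obtains a b c d e f where "xs = [a, b, c]" "ds = [d, e, f]" "a \<in> \<A> d" "b \<in> \<A> e" "c \<in> \<A> f"
  using assms by (auto simp: length_Suc_conv numeral_3_eq_3 list_all2_Cons1)

lemma word_sign_simps:
  "word_sign 2 [d0, d1] [e0, e1] = d1 * e0"
  "word_sign 3 [d0, d1, d2] [e0, e1, e2] = d1 * e0 + d2 * e0 + d2 * e1"
  by (simp_all add: word_sign_def numeral_2_eq_2 numeral_3_eq_3 algebra_simps)

lemma sum_bit: "(\<Sum>d\<in>{0, 1 :: bit}. f d) = f 0 + f 1"
  by simp

lemma parity_sign_simps: "parity_sign 0 = 1" "parity_sign 1 = - 1"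
  by (simp_all add: parity_sign_def)

text \<open>
  Contractions are finite sums, so those over different tensors commute for arbitrary \<open>f\<close>. This is
  what lets an inner sandwich be summed first.
\<close>

lemma contract_swap:
  "contract (\<lambda>x. contract (f x) Y) X = contract (\<lambda>y. contract (\<lambda>x. f x y) X) Y"
  unfolding contract_def scale_sum_right
  by (subst sum.swap) (simp add: mult.commute)

lemma contract_zero: "contract (\<lambda>x. 0) X = 0"
  by (simp add: contract_def)

lemma multilinear_0: "multilinear n (\<lambda>x. 0)"
  by (simp add: multilinear_def linear_map_intros)

definition swap_form :: "('a list \<Rightarrow> 'a) \<Rightarrow> 'a list \<Rightarrow> 'a" where
  "swap_form h xs = (\<Sum>d\<in>{0, 1}. \<Sum>e\<in>{0, 1}.
     scale (parity_sign (d * e)) (h [component e (xs ! 1), component d (xs ! 0)]))"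

lemma swap_form_hom:
  assumes h: "multilinear 2 h" and "a \<in> \<A> d" "b \<in> \<A> e"
  shows "swap_form h [a, b] = scale (parity_sign (d * e)) (h [b, a])"
  using assms linear_mapD(3)[OF multilinear2D(1)[OF h]] linear_mapD(3)[OF multilinear2D(2)[OF h]]
  unfolding swap_form_def sum_bit
  by (cases d; cases e) (auto simp: component_hom)

lemma multilinear_swap_form:
  assumes h: "multilinear 2 h"
  shows "multilinear 2 (swap_form h)"
  using linear_map_comp[OF multilinear2D(1)[OF h] linear_component]
    linear_map_comp[OF multilinear2D(2)[OF h] linear_component]
  unfolding swap_form_def
  by (intro multilinear2I linear_map_intros) simp_all

lemma contract_swap_tensor:
  assumes X: "X \<in> tensors 2"
  shows "swap 2 0 X \<in> tensors 2"
    and "multilinear 2 h \<Longrightarrow> contract h (swap 2 0 X) = contract (swap_form h) X"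
proof -
  let ?f = "\<lambda>xs. \<Sum>d\<in>{0, 1}. \<Sum>e\<in>{0, 1}. Poly_Mapping.single
       (take 0 xs @ [component e (xs ! (0 + 1)), component d (xs ! 0)] @ drop (0 + 2) xs)
       (parity_sign (d * e) :: 'k)"
  have w: "?f xs \<in> words 2" if "length xs = 2" for xs
    using that by (intro words_sum words_closed) auto
  show "swap 2 0 X \<in> tensors 2"
    unfolding swap_def by (rule induced_in_tensors[OF X w])
  assume h: "multilinear 2 h"
  have "contract h (swap 2 0 X) = contract (\<lambda>xs. lin_eval h (?f xs)) X"
    unfolding swap_def by (rule contract_induced[OF h X w])
  also have "\<dots> = contract (swap_form h) X"
    by (rule contract_words_cong[OF X]) (simp add: lin_eval_simps swap_form_def)
  finally show "contract h (swap 2 0 X) = contract (swap_form h) X" .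
qed

lemma concentrated_swap:
  assumes X: "concentrated 2 D X"
  shows "concentrated 2 D (swap 2 0 X)"
  unfolding concentrated_def
proof (intro conjI allI impI contract_swap_tensor concentratedD[OF X])
  fix h k assume h: "multilinear 2 h" and k: "multilinear 2 k"
    and eq: "\<forall>xs ds. length xs = 2 \<longrightarrow> hom_word xs ds \<longrightarrow> sum_list ds \<in> D \<longrightarrow> h xs = k xs"
  show "contract h (swap 2 0 X) = contract k (swap 2 0 X)"
    unfolding contract_swap_tensor(2)[OF concentratedD[OF X] h] contract_swap_tensor(2)[OF concentratedD[OF X] k]
  proof (rule concentrated_cong[OF X])
    fix xs ds assume x: "length xs = 2" "hom_word xs ds" "sum_list ds \<in> D"
    then obtain a b d e where *: "xs = [a, b]" "ds = [d, e]" "a \<in> \<A> d" "b \<in> \<A> e"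
      using hom_word2E by blast
    have "hom_word [b, a] [e, d]" "sum_list [e, d] \<in> D" using * x by (auto simp: add.commute)
    then have "h [b, a] = k [b, a]" using eq[rule_format, of "[b, a]" "[e, d]"] by simp
    then show "swap_form h xs = swap_form k xs"
      using * by (simp add: swap_form_hom[OF h *(3,4)] swap_form_hom[OF k *(3,4)])
  qed (intro multilinear_swap_form h k)+
qed

lemma concentrated_tmult_even:
  assumes X: "concentrated n {0} X" and Y: "concentrated n {0} Y"
  shows "concentrated n {0} (X \<odot>\<^bsub>n\<^esub> Y)"
  unfolding concentrated_def
proof (intro conjI allI impI tmult_in_tensors concentratedD[OF X] concentratedD[OF Y])
  fix h k assume h: "multilinear n h" and k: "multilinear n k"
    and eq: "\<forall>xs ds. length xs = n \<longrightarrow> hom_word xs ds \<longrightarrow> sum_list ds \<in> {0} \<longrightarrow> h xs = k xs"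
  show "contract h (X \<odot>\<^bsub>n\<^esub> Y) = contract k (X \<odot>\<^bsub>n\<^esub> Y)"
    unfolding contract_tmult[OF k concentratedD[OF X] concentratedD[OF Y]]
  proof (rule contract_tmult_concentrated[OF X Y h])
    fix xs ds ys es assume x: "length xs = n" "hom_word xs ds" "sum_list ds \<in> {0}"
      and y: "length ys = n" "hom_word ys es" "sum_list es \<in> {0}"
    have "sum_list (map2 (+) ds es) = 0"
      using x y by (subst sum_list_map2_add) (auto dest!: list_all2_lengthD)
    then have "h (map2 (*) xs ys) = k (map2 (*) xs ys)"
      using eq hom_word_mult[OF x(2) y(2)] x y by simp
    then show "scale (parity_sign (word_sign n ds es)) (h (map2 (*) xs ys)) = mult_form n k xs ys"
      using x y by (simp add: mult_form_hom[OF k])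
  qed (intro multilinear_mult_form k; assumption)+
qed

lemma contract_insert_one:
  assumes X: "X \<in> tensors 2" and i: "i \<le> 2"
  shows "insert_one 2 i X \<in> tensors 3"
    and "multilinear 3 h \<Longrightarrow> contract h (insert_one 2 i X) = contract (\<lambda>xs. h (take i xs @ [1] @ drop i xs)) X"
proof -
  let ?f = "\<lambda>xs. Poly_Mapping.single (take i xs @ [1] @ drop i xs) (1 :: 'k)"
  have w: "?f xs \<in> words (2 + 1)" if "length xs = 2" for xs
    using that i by (intro words_closed) auto
  show "insert_one 2 i X \<in> tensors 3"
    using induced_in_tensors[of X 2 ?f, OF X w] by (simp add: insert_one_def)
  assume "multilinear 3 h"
  then show "contract h (insert_one 2 i X) = contract (\<lambda>xs. h (take i xs @ [1] @ drop i xs)) X"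
    using contract_induced[of "2 + 1" h X 2 ?f, OF _ X w] by (simp add: insert_one_def lin_eval_simps)
qed

lemma contract_counit_at:
  assumes X: "X \<in> tensors 2" and i: "i < 2"
  shows "contract (\<lambda>x. x ! 0) (counit_at K 2 i X) = contract (\<lambda>xs. scale (counit K (xs ! i)) (xs ! (1 - i))) X"
proof -
  let ?f = "\<lambda>xs. Poly_Mapping.single (take i xs @ drop (i + 1) xs) (counit K (xs ! i) :: 'k)"
  have w: "?f xs \<in> words (2 - 1)" if "length xs = 2" for xs
    using that i by (intro words_closed) auto
  have m: "multilinear (2 - 1) (\<lambda>x. x ! 0)"
    by (auto simp: multilinear_def linear_map_intros)
  have "contract (\<lambda>x. x ! 0) (counit_at K 2 i X) = contract (\<lambda>xs. lin_eval (\<lambda>x. x ! 0) (?f xs)) X"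
    unfolding counit_at_def by (rule contract_induced[OF m X w])
  also have "\<dots> = contract (\<lambda>xs. scale (counit K (xs ! i)) (xs ! (1 - i))) X"
    using i by (intro contract_words_cong[OF X]) (auto elim!: length_2E simp: lin_eval_simps less_2_cases_iff)
  finally show ?thesis .
qed

end

section \<open>Contractions with the antipode\<close>

context quasi_hopf_superalgebra
begin

abbreviation S :: "'a \<Rightarrow> 'a" where "S \<equiv> antipode H"

lemma linear_map_S: "linear_map S" by (rule antipode_linear)

lemma linear_map_counit: "linear_map (\<lambda>a. scale (counit H a) x)"
proof -
  interpret c: Vector_Spaces.linear scale "(*)" "counit H" by (rule counit_linear)
  show ?thesis by (rule linear_mapI) (simp_all add: c.add c.scale scale_left_distrib)
qed

lemmas lin_intros = linear_map_intros linear_map_comp[OF linear_map_S]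
  linear_map_comp[OF linear_component] linear_map_comp[OF linear_map_counit]

lemma contract_comult_linear:
  assumes h: "multilinear 2 h"
  shows "linear_map (\<lambda>a. contract h (comult H a))"
proof (rule linear_mapI)
  note w = rep_words[OF comult_closed]
  show "contract h (comult H (a + b)) = contract h (comult H a) + contract h (comult H b)" for a b
    unfolding comult_add tadd_def contract_coset[OF h words_closed(2)[OF w w]]
    by (simp add: lin_eval_simps contract_eq_lin_eval)
  show "contract h (comult H (scale c a)) = scale c (contract h (comult H a))" for c a
    unfolding comult_scale tscale_def contract_coset[OF h words_closed(3)[OF w]]
    by (simp add: lin_eval_simps contract_eq_lin_eval)
qed

lemma contract_comult_at:
  assumes X: "X \<in> tensors 2" and i: "i < 2"
  shows "comult_at H 2 i X \<in> tensors 3"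
    and "multilinear 3 h \<Longrightarrow> contract h (comult_at H 2 i X) =
      contract (\<lambda>xs. contract (\<lambda>ys. h (take i xs @ ys @ drop (i + 1) xs)) (comult H (xs ! i))) X"
proof -
  let ?f = "\<lambda>xs. lin_ext (\<lambda>ys. Poly_Mapping.single (take i xs @ ys @ drop (i + 1) xs) 1)
       (rep (comult H (xs ! i)))"
  have w: "?f xs \<in> words (2 + 1)" if "length xs = 2" for xs
    using that i words_keysD[OF rep_words[OF comult_closed]]
    by (intro words_lin_ext words_closed) auto
  show "comult_at H 2 i X \<in> tensors 3"
    using induced_in_tensors[of X 2 ?f, OF X w] by (simp add: comult_at_def)
  assume "multilinear 3 h"
  then show "contract h (comult_at H 2 i X) =
      contract (\<lambda>xs. contract (\<lambda>ys. h (take i xs @ ys @ drop (i + 1) xs)) (comult H (xs ! i))) X"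
    using contract_induced[of "2 + 1" h X 2 ?f, OF _ X w]
    by (simp add: comult_at_def lin_eval_simps lin_eval_lin_ext flip: contract_eq_lin_eval)
qed

text \<open>
  On homogeneous letters of degrees \<open>c\<close> and \<open>d\<close> this is \<open>S(r\<^sub>1) x r\<^sub>0\<close> with the sign of exchanging
  \<open>r\<^sub>0\<close> and \<open>r\<^sub>1\<close> and of moving \<open>r\<^sub>1\<close> past something of degree \<open>e\<close>. The case \<open>e = 0\<close> is the one of
  interest; \<open>e = 1\<close> arises from products with an odd left factor.
\<close>

definition koszul :: "bit \<Rightarrow> 'a \<Rightarrow> 'a list \<Rightarrow> 'a" where
  "koszul e x r = (\<Sum>c\<in>{0, 1}. \<Sum>d\<in>{0, 1}.
     scale (parity_sign (c * d + e * d)) (S (component d (r ! 1)) * x * component c (r ! 0)))"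

lemma koszul_hom:
  "a \<in> \<A> c \<Longrightarrow> b \<in> \<A> d \<Longrightarrow> koszul e x [a, b] = scale (parity_sign (c * d + e * d)) (S b * x * a)"
  unfolding koszul_def sum_bit
  by (cases c; cases d) (auto simp: component_hom linear_mapD[OF linear_map_S])

lemma multilinear_koszul: "multilinear 2 (koszul e x)"
  unfolding koszul_def by (rule multilinear2I) (auto intro!: lin_intros simp del: sum.insert)

lemma linear_koszul: "linear_map (\<lambda>x. koszul e x r)"
  unfolding koszul_def by (intro lin_intros)

text \<open>
  Since \<open>S\<close> reverses products, \<open>S(t\<^sub>1 g\<^sub>1) x t\<^sub>0 g\<^sub>0\<close> is \<open>S(g\<^sub>1) (S(t\<^sub>1) x t\<^sub>0) g\<^sub>0\<close> up to a sign. The exponent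
  left over after the two exchange signs is \<open>(d\<^sub>0 + d\<^sub>1) e\<^sub>1\<close>, where \<open>d\<^sub>0\<close>, \<open>d\<^sub>1\<close> are the degrees in \<open>T\<close>
  and \<open>e\<^sub>1\<close> is that of \<open>g\<^sub>1\<close>; it depends on \<open>T\<close> only through its total degree.
\<close>

lemma koszul_tmult:
  assumes T: "concentrated 2 {e} T" and G: "G \<in> tensors 2"
  shows "contract (koszul 0 x) (T \<odot>\<^bsub>2\<^esub> G) = contract (koszul e (contract (koszul 0 x) T)) G"
proof -
  have "contract (koszul 0 x) (T \<odot>\<^bsub>2\<^esub> G) = contract (\<lambda>t. contract (koszul e (koszul 0 x t)) G) T"
  proof (rule contract_tmult_concentrated[OF T concentrated_UNIV[OF G] multilinear_koszul])
    fix xs ds ys es assume "length xs = 2" "hom_word xs ds" "sum_list ds \<in> {e}"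
      "length ys = 2" "hom_word ys es"
    then obtain t0 t1 d0 d1 g0 g1 e0 e1 where *: "xs = [t0, t1]" "ds = [d0, d1]" "t0 \<in> \<A> d0" "t1 \<in> \<A> d1"
      "ys = [g0, g1]" "es = [e0, e1]" "g0 \<in> \<A> e0" "g1 \<in> \<A> e1" "d0 + d1 = e"
      by (elim hom_word2E) auto
    show "scale (parity_sign (word_sign 2 ds es)) (koszul 0 x (map2 (*) xs ys)) = koszul e (koszul 0 x xs) ys"
      using *
      by (simp add: word_sign_simps koszul_hom[OF grade_mult[OF *(3,7)] grade_mult[OF *(4,8)]]
          koszul_hom[OF *(3,4)] koszul_hom[OF *(7,8)] antipode_mult[OF *(4,8)] scale_mult_left scale_mult_right mult.assoc)
        (cases d0; cases d1; cases e0; cases e1; simp add: parity_sign_simps)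
  next
    show "multilinear 2 (\<lambda>xs. koszul e (koszul 0 x xs) ys)" for ys
      unfolding koszul_def by (rule multilinear2I) (auto intro!: lin_intros simp del: sum.insert)
  qed (rule multilinear_koszul)
  also have "\<dots> = contract (koszul e (contract (koszul 0 x) T)) G"
    by (subst contract_swap, intro arg_cong[of _ _ "\<lambda>f. contract f G"] ext)
      (simp add: linear_map_of_contract[OF linear_koszul])
  finally show ?thesis .
qed

text \<open>
  The exchange sign built into \<open>koszul\<close> undoes the one of the flip.
\<close>

lemma koszul_swap:
  assumes T: "T \<in> tensors 2"
  shows "contract (koszul 0 x) (swap 2 0 T) = contract (\<lambda>t. S (t ! 0) * x * t ! 1) T"
  unfolding contract_swap_tensor(2)[OF T multilinear_koszul]
proof (rule concentrated_cong[OF concentrated_UNIV[OF T]])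
  fix xs ds assume "length xs = 2" "hom_word xs ds"
  then obtain a b d e where *: "xs = [a, b]" "ds = [d, e]" "a \<in> \<A> d" "b \<in> \<A> e"
    using hom_word2E by blast
  then show "swap_form (koszul 0 x) xs = S (xs ! 0) * x * xs ! 1"
    by (simp add: swap_form_hom[OF multilinear_koszul *(3,4)] koszul_hom[OF *(4,3)])
      (cases d; cases e; simp add: parity_sign_simps)
qed (auto intro!: multilinear_swap_form multilinear_koszul multilinear2I lin_intros)

text \<open>
  With the antipode on the first leg it is the left factor that ends up inside. For even \<open>G\<close> the
  first letter of \<open>F\<close> passes both letters of \<open>G\<close>, which together cost no sign.
\<close>

lemma alpha_form_tmult:
  assumes G: "concentrated 2 {0} G" and F: "F \<in> tensors 2"
  shows "contract (\<lambda>t. S (t ! 0) * x * t ! 1) (G \<odot>\<^bsub>2\<^esub> F) =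
    contract (\<lambda>f. S (f ! 0) * contract (\<lambda>t. S (t ! 0) * x * t ! 1) G * f ! 1) F"
proof -
  have "contract (\<lambda>t. S (t ! 0) * x * t ! 1) (G \<odot>\<^bsub>2\<^esub> F) =
    contract (\<lambda>g. contract (\<lambda>f. S (f ! 0) * (S (g ! 0) * x * g ! 1) * f ! 1) F) G"
  proof (rule contract_tmult_concentrated[OF G concentrated_UNIV[OF F]])
    fix xs ds ys es assume "length xs = 2" "hom_word xs ds" "sum_list ds \<in> {0}"
      "length ys = 2" "hom_word ys es"
    then obtain t0 t1 d0 d1 g0 g1 e0 e1 where *: "xs = [t0, t1]" "ds = [d0, d1]" "t0 \<in> \<A> d0" "t1 \<in> \<A> d1"
      "ys = [g0, g1]" "es = [e0, e1]" "g0 \<in> \<A> e0" "g1 \<in> \<A> e1" "d0 + d1 = 0"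
      by (elim hom_word2E) auto
    show "scale (parity_sign (word_sign 2 ds es)) (S (map2 (*) xs ys ! 0) * x * map2 (*) xs ys ! 1) =
      S (ys ! 0) * (S (xs ! 0) * x * xs ! 1) * ys ! 1"
      using *
      by (simp add: word_sign_simps antipode_mult[OF *(3,7)] scale_mult_left scale_mult_right mult.assoc)
        (cases d0; cases d1; cases e0; cases e1; simp add: parity_sign_simps)
  qed (auto intro!: multilinear2I lin_intros)
  also have "\<dots> = contract (\<lambda>f. S (f ! 0) * contract (\<lambda>t. S (t ! 0) * x * t ! 1) G * f ! 1) F"
  proof (subst contract_swap, intro arg_cong[of _ _ "\<lambda>f. contract f F"] ext)
    fix f
    have "linear_map (\<lambda>x. S (f ! 0) * x * f ! 1)" by (intro lin_intros)
    from linear_map_of_contract[OF this]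
    show "contract (\<lambda>t. S (f ! 0) * (S (t ! 0) * x * t ! 1) * f ! 1) G =
      S (f ! 0) * contract (\<lambda>t. S (t ! 0) * x * t ! 1) G * f ! 1" by simp
  qed
  finally show ?thesis .
qed

text \<open>
  Mirror image of \<open>alpha_form_tmult\<close>: the antipode on the second leg puts the right factor inside,
  and it is the right factor whose evenness removes the sign.
\<close>

lemma beta_form_tmult:
  assumes G: "G \<in> tensors 2" and F: "concentrated 2 {0} F"
  shows "contract (\<lambda>t. t ! 0 * x * S (t ! 1)) (G \<odot>\<^bsub>2\<^esub> F) =
    contract (\<lambda>g. g ! 0 * contract (\<lambda>t. t ! 0 * x * S (t ! 1)) F * S (g ! 1)) G"
proof -
  have "contract (\<lambda>t. t ! 0 * x * S (t ! 1)) (G \<odot>\<^bsub>2\<^esub> F) =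
    contract (\<lambda>g. contract (\<lambda>f. g ! 0 * (f ! 0 * x * S (f ! 1)) * S (g ! 1)) F) G"
  proof (rule contract_tmult_concentrated[OF concentrated_UNIV[OF G] F])
    fix xs ds ys es assume "length xs = 2" "hom_word xs ds" "sum_list es \<in> {0}"
      "length ys = 2" "hom_word ys es"
    then obtain t0 t1 d0 d1 g0 g1 e0 e1 where *: "xs = [t0, t1]" "ds = [d0, d1]" "t0 \<in> \<A> d0" "t1 \<in> \<A> d1"
      "ys = [g0, g1]" "es = [e0, e1]" "g0 \<in> \<A> e0" "g1 \<in> \<A> e1" "e0 + e1 = 0"
      by (elim hom_word2E) auto
    show "scale (parity_sign (word_sign 2 ds es)) (map2 (*) xs ys ! 0 * x * S (map2 (*) xs ys ! 1)) =
      xs ! 0 * (ys ! 0 * x * S (ys ! 1)) * S (xs ! 1)"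
      using *
      by (simp add: word_sign_simps antipode_mult[OF *(4,8)] scale_mult_left scale_mult_right mult.assoc)
        (cases d0; cases d1; cases e0; cases e1; simp add: parity_sign_simps)
  qed (auto intro!: multilinear2I lin_intros)
  also have "\<dots> = contract (\<lambda>g. g ! 0 * contract (\<lambda>t. t ! 0 * x * S (t ! 1)) F * S (g ! 1)) G"
  proof (intro arg_cong[of _ _ "\<lambda>f. contract f G"] ext)
    fix g
    have "linear_map (\<lambda>x. g ! 0 * x * S (g ! 1))" by (intro lin_intros)
    from linear_map_of_contract[OF this]
    show "contract (\<lambda>f. g ! 0 * (f ! 0 * x * S (f ! 1)) * S (g ! 1)) F =
      g ! 0 * contract (\<lambda>t. t ! 0 * x * S (t ! 1)) F * S (g ! 1)" by simp
  qed
  finally show ?thesis .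
qed

section \<open>Evenness\<close>

lemma contract_tone2: "multilinear 2 h \<Longrightarrow> contract h (tone 2) = h [1, 1]"
  by (subst contract_tone) (simp_all add: numeral_2_eq_2)

lemma homogeneous_concentrated: "homogeneous n X \<Longrightarrow> \<exists>d. concentrated n {d} X"
  unfolding homogeneous_def using concentrated_deg by blast

text \<open>
  A form that vanishes on odd words vanishes on odd tensors, so a single nonzero value certifies
  that a homogeneous tensor is even.
\<close>

lemma concentrated_even_if:
  assumes X: "concentrated n {d} X" and h: "multilinear n h"
    and odd: "\<And>xs ds. length xs = n \<Longrightarrow> hom_word xs ds \<Longrightarrow> sum_list ds = 1 \<Longrightarrow> h xs = 0"
    and nz: "contract h X \<noteq> 0"
  shows "concentrated n {0} X"
proof -
  have "contract h X = contract (\<lambda>x. 0) X" if "d = 1"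
    by (rule concentrated_cong[OF X h multilinear_0]) (use odd that in auto)
  then show ?thesis using X nz by (cases d) (simp_all add: contract_zero)
qed

text \<open>
  The scalar \<open>\<epsilon>(x\<^sub>0) \<epsilon>(x\<^sub>1)\<close> as a multiple of \<open>1\<close>, since forms take values in the algebra.
\<close>

definition counit_form :: "'a list \<Rightarrow> 'a" where
  "counit_form x = scale (counit H (x ! 0)) (scale (counit H (x ! 1)) 1)"

lemma multilinear_counit_form: "multilinear 2 counit_form"
  unfolding counit_form_def by (rule multilinear2I) (auto intro!: lin_intros simp del: scale_scale)

text \<open>
  The map \<open>\<epsilon> \<otimes> \<epsilon>\<close> is multiplicative, so it sends an invertible tensor to a nonzero scalar, whereas
  it kills odd tensors.
\<close>

lemma invertible_homogeneous_even:
  assumes inv: "tinvertible 2 X" and hom: "homogeneous 2 X"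
  shows "concentrated 2 {0} X"
proof -
  obtain d where X: "concentrated 2 {d} X" using homogeneous_concentrated[OF hom] ..
  obtain Y where Y: "Y \<in> tensors 2" "X \<odot>\<^bsub>2\<^esub> Y = tone 2"
    using inv by (auto simp: tinvertible_def is_tinverse_def)
  let ?k = "\<lambda>xs ys. scale (counit H (xs ! 0)) (scale (counit H (xs ! 1)) (counit_form ys))"
  have m: "multilinear 2 (\<lambda>xs. ?k xs ys)" for ys
    unfolding counit_form_def by (rule multilinear2I) (auto intro!: lin_intros simp del: scale_scale)
  have one: "contract counit_form (tone 2) = 1"
    by (simp add: contract_tone2[OF multilinear_counit_form]) (simp add: counit_form_def counit_one)
  have "contract counit_form (X \<odot>\<^bsub>2\<^esub> Y) = contract (\<lambda>xs. contract (?k xs) Y) X"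
  proof (rule contract_tmult_concentrated[OF X concentrated_UNIV[OF Y(1)] multilinear_counit_form m])
    fix xs ds ys es assume "length xs = 2" "hom_word xs ds" "length ys = 2" "hom_word ys es"
    then obtain t0 t1 d0 d1 g0 g1 e0 e1 where *: "xs = [t0, t1]" "ds = [d0, d1]" "t0 \<in> \<A> d0" "t1 \<in> \<A> d1"
      "ys = [g0, g1]" "es = [e0, e1]" "g0 \<in> \<A> e0" "g1 \<in> \<A> e1"
      by (elim hom_word2E) auto
    show "scale (parity_sign (word_sign 2 ds es)) (counit_form (map2 (*) xs ys)) = ?k xs ys"
      using * counit_odd
      by (cases d1; cases e0)
        (simp_all add: word_sign_simps counit_form_def counit_mult parity_sign_simps mult_ac)
  qed (auto intro!: multilinear_counit_form lin_intros multilinear2I simp: counit_form_def simp del: scale_scale)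
  then have *: "contract (\<lambda>xs. contract (?k xs) Y) X \<noteq> 0"
    using Y one by simp
  show ?thesis
  proof (rule concentrated_even_if[OF X _ _ *])
    show "multilinear 2 (\<lambda>xs. contract (?k xs) Y)"
      by (intro multilinear_contract[OF Y(1)] m)
    fix xs ds assume x: "length xs = 2" "hom_word xs ds" "sum_list ds = 1"
    then obtain a b d e where "xs = [a, b]" "ds = [d, e]" "a \<in> \<A> d" "b \<in> \<A> e"
      using hom_word2E by blast
    then have "?k xs = (\<lambda>ys. 0)"
      using x(3) counit_odd by (cases d; cases e) auto
    then show "contract (?k xs) Y = 0" by (simp only: contract_zero)
  qed
qed

text \<open>
  Applying \<open>\<epsilon>\<close> to the outer legs of \<open>(1 \<otimes> \<epsilon> \<otimes> 1) \<Phi> = 1\<close> shows \<open>(\<epsilon> \<otimes> \<epsilon> \<otimes> \<epsilon>) \<Phi> = 1\<close>.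
\<close>

lemma coassociator_even: "concentrated 3 {0} (coassociator H)"
proof -
  let ?\<Phi> = "coassociator H"
  obtain d where X: "concentrated 3 {d} ?\<Phi>" using homogeneous_concentrated[OF coassociator_homogeneous] ..
  let ?h = "\<lambda>w. scale (counit H (w ! 0)) (scale (counit H (w ! 1)) (scale (counit H (w ! 2)) 1))"
  have h: "multilinear 3 ?h" by (rule multilinear3I) (auto intro!: lin_intros simp del: scale_scale)
  let ?f = "\<lambda>xs. Poly_Mapping.single (take 1 xs @ drop (1 + 1) xs) (counit H (xs ! 1) :: 'k)"
  have w: "?f xs \<in> words (3 - 1)" if "length xs = 3" for xs
    using that by (intro words_closed) auto
  have "contract counit_form (counit_at H 3 1 ?\<Phi>) = contract (\<lambda>xs. lin_eval counit_form (?f xs)) ?\<Phi>"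
    unfolding counit_at_def
    by (rule contract_induced[OF _ concentratedD[OF X] w]) (simp_all add: multilinear_counit_form)
  also have "\<dots> = contract ?h ?\<Phi>"
    by (rule contract_words_cong[OF concentratedD[OF X]])
      (auto simp: length_Suc_conv numeral_3_eq_3 lin_eval_simps counit_form_def mult_ac)
  finally have "contract ?h ?\<Phi> = 1"
    unfolding counit_coassociator contract_tone2[OF multilinear_counit_form]
    by (simp add: counit_form_def counit_one)
  then have nz: "contract ?h ?\<Phi> \<noteq> 0" by simp
  show ?thesis
  proof (rule concentrated_even_if[OF X h _ nz])
    fix xs ds assume x: "length xs = 3" "hom_word xs ds" "sum_list ds = 1"
    then obtain a b c d e f where "xs = [a, b, c]" "ds = [d, e, f]" "a \<in> \<A> d" "b \<in> \<A> e" "c \<in> \<A> f"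
      using hom_word3E by blast
    then show "?h xs = 0"
      using x(3) counit_odd by (cases d; cases e; cases f) auto
  qed
qed

text \<open>
  If \<open>\<beta>\<close> were odd, \<open>\<epsilon>(\<beta>)\<close> would be \<open>0\<close>, and applying \<open>\<epsilon>\<close> to \<open>\<Sum> S(X) \<alpha> Y \<beta> S(Z) = 1\<close> would give
  \<open>0 = 1\<close>.
\<close>

lemma beta_even: "beta H \<in> \<A> 0"
proof (rule ccontr)
  assume "beta H \<notin> \<A> 0"
  moreover obtain d where "beta H \<in> \<A> d" using beta_homogeneous ..
  ultimately have "beta H \<in> \<A> 1" by (cases d) auto
  then have b: "counit H (beta H) = 0" by (rule counit_odd)
  have "scale (counit H 1) (1 :: 'a) = 0"
    unfolding antipode_coassociator[symmetric] linear_map_of_contract[OF linear_map_counit]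
    by (simp add: counit_mult b contract_zero)
  then show False by (simp add: counit_one)
qed

section \<open>The u-operator and its behaviour under products\<close>

text \<open>
  The summand of the \<open>u\<close>-operator as a form in \<open>w = [X, Y, Z]\<close>, with the contraction over the
  R-matrix abstracted to its value \<open>x\<close> and with \<open>b\<close> in place of \<open>\<beta>\<close>.
\<close>

definition u_form :: "'a \<Rightarrow> 'a \<Rightarrow> 'a list \<Rightarrow> 'a" where
  "u_form x b w = (\<Sum>e\<in>{0, 1}.
     scale (parity_sign e) (S (w ! 1 * b * S (w ! 2)) * x * component e (w ! 0)))"

lemma u_form_hom:
  "a \<in> \<A> d \<Longrightarrow> u_form x b [a, y, z] = scale (parity_sign d) (S (y * b * S z) * x * a)"
  unfolding u_form_def sum_bit
  by (cases d) (auto simp: component_hom)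

lemma multilinear_u_form: "multilinear 3 (u_form x b)"
  unfolding u_form_def by (rule multilinear3I) (auto intro!: lin_intros simp del: sum.insert)

lemma linear_u_form: "linear_map (\<lambda>x. u_form x b w)" "linear_map (\<lambda>b. u_form x b w)"
  unfolding u_form_def by (intro lin_intros)+

text \<open>
  For an even R-matrix the exchange sign \<open>(-1)^(d d)\<close> in \<open>koszul\<close> is the sign \<open>(-1)^d\<close> of the
  definition of the \<open>u\<close>-operator. The data \<open>K\<close> may be the twisted ones.
\<close>

lemma u_operator_eq_u_form:
  assumes R: "concentrated 2 {0} (rmatrix K)" and S: "antipode K = S"
  shows "u_operator K = contract (u_form (contract (koszul 0 (alpha K)) (rmatrix K)) (beta K)) (coassociator K)"
  unfolding u_operator_def
proof (intro arg_cong[of _ _ "\<lambda>f. contract f (coassociator K)"] ext)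
  fix w
  let ?A = "S (w ! 1 * beta K * S (w ! 2))"
  have "contract (\<lambda>r. u_form (koszul 0 (alpha K) r) (beta K) w) (rmatrix K) =
    contract (\<lambda>r. \<Sum>d\<in>{0, 1}. \<Sum>e\<in>{0, 1}. scale (parity_sign (d + e))
      (?A * S (r ! 1) * alpha K * component d (r ! 0) * component e (w ! 0))) (rmatrix K)"
  proof (rule concentrated_cong[OF R])
    show "multilinear 2 (\<lambda>r. u_form (koszul 0 (alpha K) r) (beta K) w)"
      unfolding u_form_def koszul_def
      by (rule multilinear2I) (auto intro!: lin_intros simp del: sum.insert)
    show "multilinear 2 (\<lambda>r. \<Sum>d\<in>{0, 1}. \<Sum>e\<in>{0, 1}. scale (parity_sign (d + e))
      (?A * S (r ! 1) * alpha K * component d (r ! 0) * component e (w ! 0)))"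
      by (rule multilinear2I) (auto intro!: lin_intros simp del: sum.insert)
    fix xs ds assume "length xs = 2" "hom_word xs ds" "sum_list ds \<in> {0}"
    then obtain a b d e where *: "xs = [a, b]" "ds = [d, e]" "a \<in> \<A> d" "b \<in> \<A> e" "d + e = 0"
      by (elim hom_word2E) auto
    then show "u_form (koszul 0 (alpha K) xs) (beta K) w =
      (\<Sum>d\<in>{0, 1}. \<Sum>e\<in>{0, 1}. scale (parity_sign (d + e))
        (?A * S (xs ! 1) * alpha K * component d (xs ! 0) * component e (w ! 0)))"
      unfolding sum_bit u_form_def
      by (cases d; cases e) (auto simp: koszul_hom[OF *(3,4)] component_hom[OF *(3)] parity_sign_simps mult.assoc)
  qed
  then show "contract (\<lambda>r. \<Sum>d\<in>{0, 1}. \<Sum>e\<in>{0, 1}. scale (parity_sign (d + e))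
      (antipode K (w ! 1 * beta K * antipode K (w ! 2)) * antipode K (r ! 1) * alpha K *
        component d (r ! 0) * component e (w ! 0))) (rmatrix K) =
    u_form (contract (koszul 0 (alpha K)) (rmatrix K)) (beta K) w"
    by (simp only: S linear_map_of_contract[OF linear_u_form(1)])
qed

text \<open>
  A right factor \<open>1 \<otimes> G\<close> enters only the product \<open>Y b S(Z)\<close>, where it surrounds \<open>b\<close>.
\<close>

lemma u_form_right_insert:
  assumes W: "W \<in> tensors 3" and G: "concentrated 2 {0} G"
  shows "contract (u_form x b) (W \<odot>\<^bsub>3\<^esub> insert_one 2 0 G) =
    contract (u_form x (contract (\<lambda>g. g ! 0 * b * S (g ! 1)) G)) W"
proof -
  note GT = concentratedD[OF G] and mu = multilinear_u_form
  have "contract (u_form x b) (W \<odot>\<^bsub>3\<^esub> insert_one 2 0 G) =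
    contract (\<lambda>w. contract (mult_form 3 (u_form x b) w) (insert_one 2 0 G)) W"
    by (intro contract_tmult mu W contract_insert_one GT) simp
  also have "\<dots> = contract (\<lambda>w. contract (\<lambda>g. mult_form 3 (u_form x b) w [1, g ! 0, g ! 1]) G) W"
  proof (rule contract_words_cong[OF W])
    fix w :: "'a list" assume w: "length w = 3"
    have "contract (mult_form 3 (u_form x b) w) (insert_one 2 0 G) =
      contract (\<lambda>g. mult_form 3 (u_form x b) w (take 0 g @ [1] @ drop 0 g)) G"
      by (rule contract_insert_one(2)[OF GT]) (auto intro!: multilinear_mult_form mu w)
    also have "\<dots> = contract (\<lambda>g. mult_form 3 (u_form x b) w [1, g ! 0, g ! 1]) G"
      by (rule contract_words_cong[OF GT]) (auto elim!: length_2E)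
    finally show "contract (mult_form 3 (u_form x b) w) (insert_one 2 0 G) =
      contract (\<lambda>g. mult_form 3 (u_form x b) w [1, g ! 0, g ! 1]) G" .
  qed
  also have "\<dots> = contract (u_form x (contract (\<lambda>g. g ! 0 * b * S (g ! 1)) G)) W"
  proof (rule concentrated_cong[OF concentrated_UNIV[OF W]])
    fix w ds assume w: "length w = 3" "hom_word w ds"
    then obtain w0 w1 w2 d0 d1 d2 where *: "w = [w0, w1, w2]" "ds = [d0, d1, d2]"
      "w0 \<in> \<A> d0" "w1 \<in> \<A> d1" "w2 \<in> \<A> d2" using hom_word3E by blast
    have "contract (\<lambda>g. mult_form 3 (u_form x b) w [1, g ! 0, g ! 1]) G =
      contract (\<lambda>g. u_form x (g ! 0 * b * S (g ! 1)) w) G"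
    proof (rule concentrated_cong[OF G])
      fix g es assume "length g = 2" "hom_word g es" "sum_list es \<in> {0}"
      then obtain g0 g1 e0 e1 where g: "g = [g0, g1]" "es = [e0, e1]" "g0 \<in> \<A> e0" "g1 \<in> \<A> e1" "e0 + e1 = 0"
        by (elim hom_word2E) auto
      have "hom_word [1, g0, g1] [0, e0, e1]" using g grade_one by simp
      from mult_form_hom[OF mu w(2,1) this]
      show "mult_form 3 (u_form x b) w [1, g ! 0, g ! 1] = u_form x (g ! 0 * b * S (g ! 1)) w"
        using g *
        by (simp add: word_sign_simps u_form_hom[OF *(3)] antipode_mult[OF *(5) g(4)] scale_mult_left
            scale_mult_right mult.assoc linear_mapD[OF linear_map_S])
          (cases d0; cases d2; cases e0; cases e1; simp add: parity_sign_simps)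
    next
      show "multilinear 2 (\<lambda>g. mult_form 3 (u_form x b) w [1, g ! 0, g ! 1])"
        by (rule multilinear2I) (auto intro!: multilinear3D multilinear_mult_form mu w)
      show "multilinear 2 (\<lambda>g. u_form x (g ! 0 * b * S (g ! 1)) w)"
        unfolding u_form_def by (rule multilinear2I) (auto intro!: lin_intros simp del: sum.insert)
    qed
    then show "contract (\<lambda>g. mult_form 3 (u_form x b) w [1, g ! 0, g ! 1]) G =
      u_form x (contract (\<lambda>g. g ! 0 * b * S (g ! 1)) G) w"
      by (simp add: linear_map_of_contract[OF linear_u_form(2)])
  qed (auto intro!: multilinear_contract[OF GT] multilinear_mult_form mu)
  finally show ?thesis .
qed

lemma comult_concentrated: "a \<in> \<A> d \<Longrightarrow> concentrated 2 {d} (comult H a)"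
  by (rule concentrated_deg) (rule comult_grade)

text \<open>
  A right factor \<open>(1 \<otimes> \<Delta>) G\<close> places \<open>\<Sum> a\<^sub>(\<^sub>1\<^sub>) \<beta> S(a\<^sub>(\<^sub>2\<^sub>)) = \<epsilon>(a) \<beta>\<close> in the middle, where \<open>a\<close> is the
  second leg of \<open>G\<close>. The first leg is then weighted by \<open>\<epsilon>(a)\<close> and sums to \<open>1\<close>.
\<close>

lemma u_form_right_comult:
  assumes W: "W \<in> tensors 3" and G: "concentrated 2 {0} G"
    and counit: "contract (\<lambda>g. scale (counit H (g ! 1)) (g ! 0)) G = 1"
  shows "contract (u_form x (beta H)) (W \<odot>\<^bsub>3\<^esub> comult_at H 2 1 G) = contract (u_form x (beta H)) W"
proof -
  note GT = concentratedD[OF G] and mu = multilinear_u_form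
  let ?u = "u_form x (beta H)"
  let ?m = "\<lambda>w g c. mult_form 3 ?u w [g ! 0, c ! 0, c ! 1]"
  have "contract ?u (W \<odot>\<^bsub>3\<^esub> comult_at H 2 1 G) =
    contract (\<lambda>w. contract (mult_form 3 ?u w) (comult_at H 2 1 G)) W"
    by (intro contract_tmult mu W contract_comult_at GT) simp
  also have "\<dots> = contract (\<lambda>w. contract (\<lambda>g. contract (?m w g) (comult H (g ! 1))) G) W"
  proof (rule contract_words_cong[OF W])
    fix w :: "'a list" assume w: "length w = 3"
    have "contract (mult_form 3 ?u w) (comult_at H 2 1 G) =
      contract (\<lambda>g. contract (\<lambda>c. mult_form 3 ?u w (take 1 g @ c @ drop (1 + 1) g)) (comult H (g ! 1))) G"
      by (rule contract_comult_at(2)[OF GT]) (auto intro!: multilinear_mult_form mu w)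
    also have "\<dots> = contract (\<lambda>g. contract (?m w g) (comult H (g ! 1))) G"
      by (rule contract_words_cong[OF GT], rule contract_words_cong[OF comult_closed])
        (auto elim!: length_2E)
    finally show "contract (mult_form 3 ?u w) (comult_at H 2 1 G) =
      contract (\<lambda>g. contract (?m w g) (comult H (g ! 1))) G" .
  qed
  also have "\<dots> = contract ?u W"
  proof (rule concentrated_cong[OF concentrated_UNIV[OF W]])
    fix w ds assume w: "length w = 3" "hom_word w ds"
    then obtain w0 w1 w2 d0 d1 d2 where *: "w = [w0, w1, w2]" "ds = [d0, d1, d2]"
      "w0 \<in> \<A> d0" "w1 \<in> \<A> d1" "w2 \<in> \<A> d2" using hom_word3E by blast
    have mm: "multilinear 3 (mult_form 3 ?u w)" by (intro multilinear_mult_form mu w)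
    have "contract (\<lambda>g. contract (?m w g) (comult H (g ! 1))) G =
      contract (\<lambda>g. ?u [w0 * scale (counit H (g ! 1)) (g ! 0), w1, w2]) G"
    proof (rule concentrated_cong[OF G])
      fix g es assume "length g = 2" "hom_word g es" "sum_list es \<in> {0}"
      then obtain g0 g1 e0 e1 where g: "g = [g0, g1]" "es = [e0, e1]" "g0 \<in> \<A> e0" "g1 \<in> \<A> e1" "e0 + e1 = 0"
        by (elim hom_word2E) auto
      (* The contributions of w2 cancel, because g is even; moving g0 past w1 remains. *)
      let ?k = "\<lambda>y. scale (parity_sign (d1 * e0)) (u_form x y [w0 * g0, w1, w2])"
      have k: "linear_map ?k" by (intro lin_intros linear_u_form)
      have "contract (?m w g) (comult H g1) =
        contract (\<lambda>c. ?k (c ! 0 * beta H * S (c ! 1))) (comult H g1)"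
      proof (rule concentrated_cong[OF comult_concentrated[OF g(4)]])
        fix c fs assume "length c = 2" "hom_word c fs" "sum_list fs \<in> {e1}"
        then obtain c0 c1 f0 f1 where c: "c = [c0, c1]" "fs = [f0, f1]" "c0 \<in> \<A> f0" "c1 \<in> \<A> f1" "f0 + f1 = e1"
          by (elim hom_word2E) auto
        have "hom_word [g0, c0, c1] [e0, f0, f1]" using g c by simp
        from mult_form_hom[OF mu w(2,1) this]
        show "?m w g c = ?k (c ! 0 * beta H * S (c ! 1))"
          using g * c
          by (simp add: word_sign_simps u_form_hom[OF grade_mult[OF *(3) g(3)]] antipode_mult[OF *(5) c(4)]
              scale_mult_left scale_mult_right mult.assoc linear_mapD[OF linear_map_S])
            (cases d0; cases d1; cases d2; cases e0; cases f0; cases f1; simp add: parity_sign_simps)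
      next
        show "multilinear 2 (?m w g)"
          by (rule multilinear2I) (auto intro!: multilinear3D mm)
        show "multilinear 2 (\<lambda>c. ?k (c ! 0 * beta H * S (c ! 1)))"
          by (rule multilinear2I) (auto intro!: linear_map_comp[OF linear_u_form(2)] lin_intros)
      qed
      also have "\<dots> = ?k (scale (counit H g1) (beta H))"
        unfolding antipode_beta[symmetric] by (rule linear_map_of_contract[OF k, symmetric])
      (* The remaining sign is harmless: for odd g1 the counit vanishes, otherwise e0 = e1 = 0. *)
      also have "\<dots> = ?u [w0 * scale (counit H g1) g0, w1, w2]"
        using g counit_odd
        by (cases e1) (auto simp: linear_mapD[OF linear_u_form(2)] scale_mult_right
            linear_mapD[OF multilinear3D(1)[OF mu]] parity_sign_simps)
      finally show "contract (?m w g) (comult H (g ! 1)) = ?u [w0 * scale (counit H (g ! 1)) (g ! 0), w1, w2]"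
        using g by simp
    next
      show "multilinear 2 (\<lambda>g. contract (?m w g) (comult H (g ! 1)))"
        by (rule multilinear2I)
          (auto intro!: linear_map_contract[OF comult_closed] multilinear3D contract_comult_linear multilinear2I mm)
      show "multilinear 2 (\<lambda>g. ?u [w0 * scale (counit H (g ! 1)) (g ! 0), w1, w2])"
        by (rule multilinear2I)
          (auto intro!: linear_map_comp[OF multilinear3D(1)[OF mu]] lin_intros)
    qed
    also have "\<dots> = ?u [w0 * contract (\<lambda>g. scale (counit H (g ! 1)) (g ! 0)) G, w1, w2]"
      using linear_map_of_contract[OF linear_map_comp[OF multilinear3D(1)[OF mu] linear_map_intros(4)[OF linear_map_intros(1)]], symmetric] .
    also have "\<dots> = ?u w" using * counit by simp
    finally show "contract (\<lambda>g. contract (?m w g) (comult H (g ! 1))) G = ?u w" .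
  next
    show "multilinear 3 (\<lambda>w. contract (\<lambda>g. contract (?m w g) (comult H (g ! 1))) G)"
      by (intro multilinear_contract[OF GT] multilinear_contract[OF comult_closed] multilinear_mult_form mu) simp
  qed (rule mu)
  finally show ?thesis .
qed

text \<open>
  For letters \<open>f\<close> of \<open>F \<otimes> 1\<close> and \<open>c\<^sub>0, c\<^sub>1, b\<^sub>1\<close> of \<open>(\<Delta> \<otimes> 1) F\<close> with \<open>c\<close> from \<open>\<Delta>(b\<^sub>0)\<close>, the summand is
  \<open>S(S(b\<^sub>1)) S(Y \<beta> S(Z)) S(c\<^sub>1) (S(f\<^sub>1) x f\<^sub>0) c\<^sub>0 X\<close> up to sign. Summing over \<open>f\<close> turns \<open>x\<close> into \<open>y\<close>,
  summing over \<open>c\<close> gives \<open>\<epsilon>(b\<^sub>0) y\<close>, and summing over \<open>b\<close> turns \<open>S(S(b\<^sub>1))\<close> into \<open>1\<close>.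
\<close>

lemma u_form_left:
  assumes F: "concentrated 2 {0} F" and W: "concentrated 3 {0} W"
    and counit: "contract (\<lambda>f. scale (counit H (f ! 0)) (f ! 1)) F = 1"
    and x: "contract (koszul 0 x) F = y"
    and y: "\<And>a d. a \<in> \<A> d \<Longrightarrow> contract (koszul 0 y) (comult H a) = scale (counit H a) y"
  shows "contract (u_form x (beta H)) (insert_one 2 2 F \<odot>\<^bsub>3\<^esub> comult_at H 2 0 F \<odot>\<^bsub>3\<^esub> W) =
    contract (u_form y (beta H)) W"
proof -
  note FT = concentratedD[OF F] and WT = concentratedD[OF W] and mu = multilinear_u_form
  note I = contract_insert_one[OF FT order_refl] and C = contract_comult_at[OF FT, of 0, simplified]
  let ?u = "u_form x (beta H)" and ?V = "insert_one 2 2 F \<odot>\<^bsub>3\<^esub> comult_at H 2 0 F"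
  have VT: "?V \<in> tensors 3" by (intro tmult_in_tensors I C)
  have "contract ?u (?V \<odot>\<^bsub>3\<^esub> W) = contract (\<lambda>w. contract (\<lambda>v. mult_form 3 ?u v w) ?V) W"
    by (simp only: contract_tmult[OF mu VT WT] contract_swap[of _ W ?V])
  also have "\<dots> = contract (u_form y (beta H)) W"
  proof (rule concentrated_cong[OF W])
    fix w ds assume w: "length w = 3" "hom_word w ds" "sum_list ds \<in> {0}"
    then obtain w0 w1 w2 d0 d1 d2 where *: "w = [w0, w1, w2]" "ds = [d0, d1, d2]"
      "w0 \<in> \<A> d0" "w1 \<in> \<A> d1" "w2 \<in> \<A> d2" "d0 + d1 + d2 = 0"
      by (elim hom_word3E) (auto simp: add.assoc)
    (* For a fixed word w of the right factor, the rest is a form m in the word of the left one. *)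
    define m where "m = (\<lambda>v. mult_form 3 ?u v w)"
    have m: "multilinear 3 m" unfolding m_def by (intro multilinear_mult_form mu w)
    note mm = multilinear_mult_form[OF m]
    let ?e = "\<lambda>f b c. mult_form 3 m [f ! 0, f ! 1, 1] [c ! 0, c ! 1, b ! 1]"
    let ?Q = "S (w1 * beta H * S w2)"
    have "contract m ?V = contract (\<lambda>i. contract (mult_form 3 m i) (comult_at H 2 0 F)) (insert_one 2 2 F)"
      by (intro contract_tmult m I C)
    also have "\<dots> = contract (\<lambda>f. contract (mult_form 3 m (take 2 f @ [1] @ drop 2 f)) (comult_at H 2 0 F)) F"
      by (intro I(2) multilinear_contract[OF C(1)] mm)
    also have "\<dots> = contract (\<lambda>f. contract (\<lambda>b. contract (?e f b) (comult H (b ! 0))) F) F"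
    proof (rule contract_words_cong[OF FT])
      fix f :: "'a list" assume f: "length f = 2"
      have "contract (mult_form 3 m (take 2 f @ [1] @ drop 2 f)) (comult_at H 2 0 F) =
        contract (\<lambda>b. contract (\<lambda>c. mult_form 3 m (take 2 f @ [1] @ drop 2 f) (c @ drop 1 b)) (comult H (b ! 0))) F"
        using f C(2)[OF mm(2), of "take 2 f @ [1] @ drop 2 f"] by simp
      also have "\<dots> = contract (\<lambda>b. contract (?e f b) (comult H (b ! 0))) F"
        using f by (intro contract_words_cong[OF FT] contract_words_cong[OF comult_closed])
          (auto elim!: length_2E)
      finally show "contract (mult_form 3 m (take 2 f @ [1] @ drop 2 f)) (comult_at H 2 0 F) =
        contract (\<lambda>b. contract (?e f b) (comult H (b ! 0))) F" .
    qed
    (* Reorder, so that the innermost sandwich, the one over f, is summed first. *)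
    also have "\<dots> = contract (\<lambda>b. contract (\<lambda>c. contract (\<lambda>f. ?e f b c) F) (comult H (b ! 0))) F"
      by (subst contract_swap) (subst contract_swap[of _ "comult H _" F], rule refl)
    also have "\<dots> = contract (\<lambda>b. scale (parity_sign d0)
        (S (S (scale (counit H (b ! 0)) (b ! 1))) * ?Q * y * w0)) F"
    proof (rule concentrated_cong[OF F])
      fix b es assume "length b = 2" "hom_word b es" "sum_list es \<in> {0}"
      then obtain b0 b1 e where b: "b = [b0, b1]" "es = [e, e]" "b0 \<in> \<A> e" "b1 \<in> \<A> e"
        by (elim hom_word2E) (auto, metis add_cancel_right_left add.commute bit_not_zero_iff bit_2_eq_0 one_add_one)
      (* The sign that is left once koszul has absorbed those of f and c. It depends only on the
         degrees e of b1 and d0 of w0, and for e = 0 it is the sign of u_form. *)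
      let ?k = "\<lambda>z. scale (parity_sign (e + d0 + e * d0)) (S (S b1) * ?Q * z * w0)"
      have k: "linear_map ?k" by (intro lin_intros)
      have "contract (\<lambda>c. contract (\<lambda>f. ?e f b c) F) (comult H b0) =
        contract (\<lambda>c. ?k (koszul 0 y c)) (comult H b0)"
      proof (rule concentrated_cong[OF comult_concentrated[OF b(3)]])
        fix c gs assume "length c = 2" "hom_word c gs" "sum_list gs \<in> {e}"
        then obtain c0 c1 g0 g1 where c: "c = [c0, c1]" "gs = [g0, g1]" "c0 \<in> \<A> g0" "c1 \<in> \<A> g1" "g0 + g1 = e"
          by (elim hom_word2E) auto
        have "contract (\<lambda>f. ?e f b c) F = contract (\<lambda>f. ?k (koszul 0 (koszul 0 x f) c)) F"
        proof (rule concentrated_cong[OF F])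
          fix f hs assume "length f = 2" "hom_word f hs" "sum_list hs \<in> {0}"
          then obtain f0 f1 h0 h1 where f: "f = [f0, f1]" "hs = [h0, h1]" "f0 \<in> \<A> h0" "f1 \<in> \<A> h1" "h0 + h1 = 0"
            by (elim hom_word2E) auto
          have hw: "hom_word [f0, f1, 1] [h0, h1, 0]" "hom_word [c0, c1, b1] [g0, g1, e]"
            "hom_word [f0 * c0, f1 * c1, b1] [h0 + g0, h1 + g1, e]"
            using f c b grade_one grade_mult by auto
          have q: "w1 * beta H * S w2 \<in> \<A> (d1 + 0 + d2)"
            by (intro grade_mult beta_even antipode_grade *)
          (* Apply S to one product after the other, recording the exponents; d1 + 0 + d2 is the
             degree of w1 * beta H * S w2. *)
          have "S (f1 * c1 * w1 * beta H * S (b1 * w2)) =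
              scale (parity_sign (e * d2)) (S (f1 * (c1 * ((w1 * beta H * S w2) * S b1))))"
            by (simp add: antipode_mult[OF b(4) *(5)] linear_mapD[OF linear_map_S] scale_mult_right mult.assoc)
          also have "\<dots> = scale (parity_sign (e * d2 + h1 * (g1 + (d1 + 0 + d2 + e)) + g1 * (d1 + 0 + d2 + e) + (d1 + 0 + d2) * e))
              (S (S b1) * ?Q * S c1 * S f1)"
            using antipode_mult[OF f(4) grade_mult[OF c(4) grade_mult[OF q antipode_grade[OF b(4)]]]]
              antipode_mult[OF c(4) grade_mult[OF q antipode_grade[OF b(4)]]]
              antipode_mult[OF q antipode_grade[OF b(4)]]
            by (simp add: scale_mult_left scale_mult_right parity_sign_add mult.assoc mult_ac)
          finally have SS: "S (f1 * c1 * w1 * beta H * S (b1 * w2)) =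
            scale (parity_sign (e * d2 + h1 * (g1 + (d1 + 0 + d2 + e)) + g1 * (d1 + 0 + d2 + e) + (d1 + 0 + d2) * e))
              (S (S b1) * ?Q * S c1 * S f1)" .
          have "?e f b c = scale (parity_sign (h1 * g0)) (m [f0 * c0, f1 * c1, b1])"
            using mult_form_hom[OF m hw(1) _ hw(2)] f b c by (simp add: word_sign_simps)
          also have "m [f0 * c0, f1 * c1, b1] =
              scale (parity_sign ((h1 + g1) * d0 + e * d0 + e * d1 + (h0 + g0 + d0)))
               (S (f1 * c1 * w1 * beta H * S (b1 * w2)) * x * (f0 * c0 * w0))"
            using mult_form_hom[OF mu hw(3) _ w(2,1)] *(1,2)
              u_form_hom[OF grade_mult[OF grade_mult[OF f(3) c(3)] *(3)]]
            by (simp add: m_def word_sign_simps parity_sign_add)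
          also have "scale (parity_sign (h1 * g0)) \<dots> = ?k (koszul 0 (koszul 0 x f) c)"
            unfolding SS using f b c *(6)
            by (simp add: koszul_hom[OF f(3,4)] koszul_hom[OF c(3,4)] scale_mult_left scale_mult_right mult.assoc)
              (cases h0; cases h1; cases g0; cases g1; cases d0; cases d1; cases d2; simp add: parity_sign_simps)
          finally show "?e f b c = ?k (koszul 0 (koszul 0 x f) c)" .
        next
          show "multilinear 2 (\<lambda>f. ?e f b c)"
            by (rule multilinear2I) (auto intro!: multilinear3D mm)
          show "multilinear 2 (\<lambda>f. ?k (koszul 0 (koszul 0 x f) c))"
            unfolding koszul_def by (rule multilinear2I) (auto intro!: lin_intros simp del: sum.insert)
        qed
        also have "\<dots> = ?k (koszul 0 y c)"
          unfolding x[symmetric] by (rule linear_map_of_contract[OF linear_map_comp[OF k linear_koszul], symmetric])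
        finally show "contract (\<lambda>f. ?e f b c) F = ?k (koszul 0 y c)" .
      next
        show "multilinear 2 (\<lambda>c. contract (\<lambda>f. ?e f b c) F)"
          by (rule multilinear2I) (auto intro!: multilinear3D multilinear_contract[OF FT] mm)
        show "multilinear 2 (\<lambda>c. ?k (koszul 0 y c))"
          by (rule multilinear2I) (rule linear_map_comp[OF k multilinear2D(1)[OF multilinear_koszul]]
              linear_map_comp[OF k multilinear2D(2)[OF multilinear_koszul]])+
      qed
      also have "\<dots> = ?k (contract (koszul 0 y) (comult H b0))"
        by (rule linear_map_of_contract[OF k, symmetric])
      also have "\<dots> = scale (parity_sign d0) (S (S (scale (counit H b0) b1)) * ?Q * y * w0)"
        unfolding y[OF b(3)] using b(3) counit_odd
        by (cases e) (auto simp: linear_mapD[OF linear_map_S] scale_mult_left scale_mult_right mult_ac)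
      finally show "contract (\<lambda>c. contract (\<lambda>f. ?e f b c) F) (comult H (b ! 0)) =
        scale (parity_sign d0) (S (S (scale (counit H (b ! 0)) (b ! 1))) * ?Q * y * w0)"
        using b by simp
    next
      show "multilinear 2 (\<lambda>b. contract (\<lambda>c. contract (\<lambda>f. ?e f b c) F) (comult H (b ! 0)))"
        by (rule multilinear2I)
          (auto intro!: linear_map_contract[OF comult_closed] multilinear3D multilinear_contract[OF FT]
            contract_comult_linear multilinear2I mm)
      show "multilinear 2 (\<lambda>b. scale (parity_sign d0) (S (S (scale (counit H (b ! 0)) (b ! 1))) * ?Q * y * w0))"
        by (rule multilinear2I) (auto intro!: lin_intros)
    qed
    also have "\<dots> = scale (parity_sign d0) (S (S (contract (\<lambda>b. scale (counit H (b ! 0)) (b ! 1)) F)) * ?Q * y * w0)"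
    proof (rule linear_map_of_contract[symmetric])
      show "linear_map (\<lambda>z. scale (parity_sign d0) (S (S z) * ?Q * y * w0))" by (intro lin_intros)
    qed
    also have "\<dots> = u_form y (beta H) w"
      unfolding counit using * by (simp add: antipode_one u_form_hom[OF *(3)])
    finally show "contract (\<lambda>v. mult_form 3 ?u v w) ?V = u_form y (beta H) w"
      unfolding m_def .
  next
    show "multilinear 3 (\<lambda>w. contract (\<lambda>v. mult_form 3 ?u v w) ?V)"
      by (intro multilinear_contract[OF VT] multilinear_mult_form mu)
  qed (rule mu)
  finally show ?thesis .
qed

text \<open>
  \<open>1 \<otimes> \<epsilon>\<close> is multiplicative: a product of tensors carries a sign only when the second leg
  of the left factor is odd, and then \<open>\<epsilon>\<close> kills that leg.
\<close>

lemma right_counit_inverse: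
  assumes G: "G \<in> tensors 2" and F: "F \<in> tensors 2" and GF: "G \<odot>\<^bsub>2\<^esub> F = tone 2"
    and counit: "contract (\<lambda>f. scale (counit H (f ! 1)) (f ! 0)) F = 1"
  shows "contract (\<lambda>g. scale (counit H (g ! 1)) (g ! 0)) G = 1"
proof -
  let ?c = "\<lambda>f. scale (counit H (f ! 1)) (f ! 0)"
  have m: "multilinear 2 ?c" by (rule multilinear2I) (auto intro!: lin_intros)
  have "contract ?c (G \<odot>\<^bsub>2\<^esub> F) = contract (\<lambda>g. contract (\<lambda>f. ?c g * ?c f) F) G"
  proof (rule contract_tmult_concentrated[OF concentrated_UNIV[OF G] concentrated_UNIV[OF F] m])
    fix xs ds ys es assume "length xs = 2" "hom_word xs ds" "length ys = 2" "hom_word ys es"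
    then obtain t0 t1 d0 d1 g0 g1 e0 e1 where *: "xs = [t0, t1]" "ds = [d0, d1]" "t0 \<in> \<A> d0" "t1 \<in> \<A> d1"
      "ys = [g0, g1]" "es = [e0, e1]" "g0 \<in> \<A> e0" "g1 \<in> \<A> e1"
      by (elim hom_word2E) auto
    show "scale (parity_sign (word_sign 2 ds es)) (?c (map2 (*) xs ys)) = ?c xs * ?c ys"
      using * counit_odd
      by (cases d1) (auto simp: word_sign_simps parity_sign_simps counit_mult scale_mult_left scale_mult_right mult_ac)
  qed (auto intro!: multilinear2I lin_intros)
  also have "\<dots> = contract (\<lambda>g. ?c g * contract ?c F) G"
    by (subst linear_map_of_contract) (auto intro!: lin_intros)
  also have "\<dots> = contract ?c G" by (simp only: counit mult_1_right)
  finally show ?thesis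
    unfolding GF contract_tone2[OF m] by (simp add: counit_one)
qed

end

section \<open>Invariance under twisting\<close>

context quasi_triangular_quasi_hopf_superalgebra
begin

lemma rmatrix_even: "concentrated 2 {0} (rmatrix H)"
  by (intro invertible_homogeneous_even rmatrix_invertible rmatrix_homogeneous)

abbreviation \<gamma> :: 'a where "\<gamma> \<equiv> contract (koszul 0 (alpha H)) (rmatrix H)"

text \<open>
  Both sides come from \<open>R \<Delta>(a) = \<Delta>\<^sup>T(a) R\<close>. On the left \<open>\<gamma>\<close> is inside and \<open>\<Delta>(a)\<close> outside; on the right
  \<open>\<Delta>\<^sup>T(a)\<close> is next to \<open>\<alpha>\<close>, where the antipode axiom reduces it to \<open>\<epsilon>(a)\<close>. For odd \<open>a\<close> the extra sign of
  \<open>koszul_tmult\<close> does not matter, since then \<open>\<epsilon>(a) = 0\<close>.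
\<close>

lemma gamma_comult:
  assumes a: "a \<in> \<A> d"
  shows "contract (koszul 0 \<gamma>) (comult H a) = scale (counit H a) \<gamma>"
proof -
  note R = concentratedD[OF rmatrix_even]
  have "contract (koszul 0 \<gamma>) (comult H a) = contract (koszul 0 (alpha H)) (swap 2 0 (comult H a) \<odot>\<^bsub>2\<^esub> rmatrix H)"
    by (simp only: koszul_tmult[OF rmatrix_even comult_closed] rmatrix_comult)
  also have "\<dots> = contract (koszul d (contract (koszul 0 (alpha H)) (swap 2 0 (comult H a)))) (rmatrix H)"
    by (rule koszul_tmult[OF concentrated_swap[OF comult_concentrated[OF a]] R])
  also have "\<dots> = contract (koszul d (scale (counit H a) (alpha H))) (rmatrix H)"
    by (simp only: koszul_swap[OF comult_closed] antipode_alpha)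
  also have "\<dots> = contract (\<lambda>r. scale (counit H a) (koszul 0 (alpha H) r)) (rmatrix H)"
  proof -
    have "koszul d (scale (counit H a) (alpha H)) r = scale (counit H a) (koszul 0 (alpha H) r)" for r
      using a counit_odd by (cases d) (auto simp: linear_mapD[OF linear_koszul])
    then show ?thesis by presburger
  qed
  also have "\<dots> = scale (counit H a) \<gamma>"
    by (rule linear_map_of_contract[symmetric]) (intro lin_intros)
  finally show ?thesis .
qed

lemma u_operator_twist:
  assumes "twistor H F"
  shows "u_operator (twist F H) = u_operator H"
proof -
  define G where "G = tinv 2 F"
  have F: "concentrated 2 {0} F" and inv: "tinvertible 2 F"
    and cF: "counit_at H 2 0 F = tone 1" "counit_at H 2 1 F = tone 1"
    using assms invertible_homogeneous_even by (auto simp: twistor_def)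
  note FT = concentratedD[OF F] and R = rmatrix_even and RT = concentratedD[OF rmatrix_even]
    and W = coassociator_even and WT = concentratedD[OF coassociator_even]
  have G: "concentrated 2 {0} G" unfolding G_def by (rule concentrated_tinv[OF F inv])
  note GT = concentratedD[OF G]
  have GF: "G \<odot>\<^bsub>2\<^esub> F = tone 2"
    using is_tinverse_tinv[OF inv] by (simp add: is_tinverse_def G_def)
  have one: "contract (\<lambda>x. x ! 0) (tone 1) = 1"
    by (subst contract_tone) (auto simp: multilinear_def linear_map_intros)
  have c0: "contract (\<lambda>f. scale (counit H (f ! 0)) (f ! 1)) F = 1"
    using contract_counit_at[OF FT, of 0 H] cF one by simp
  have c1: "contract (\<lambda>f. scale (counit H (f ! 1)) (f ! 0)) F = 1"
    using contract_counit_at[OF FT, of 1 H] cF one by simp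
  have c1': "contract (\<lambda>g. scale (counit H (g ! 1)) (g ! 0)) G = 1"
    by (rule right_counit_inverse[OF GT FT GF c1])
  let ?K = "twist F H"
  have K: "antipode ?K = S" "rmatrix ?K = swap 2 0 F \<odot>\<^bsub>2\<^esub> rmatrix H \<odot>\<^bsub>2\<^esub> G"
    "coassociator ?K = insert_one 2 2 F \<odot>\<^bsub>3\<^esub> comult_at H 2 0 F \<odot>\<^bsub>3\<^esub> coassociator H
           \<odot>\<^bsub>3\<^esub> comult_at H 2 1 G \<odot>\<^bsub>3\<^esub> insert_one 2 0 G"
    "alpha ?K = contract (\<lambda>f. S (f ! 0) * alpha H * f ! 1) G"
    "beta ?K = contract (\<lambda>f. f ! 0 * beta H * S (f ! 1)) F"
    by (simp_all add: twist_def G_def)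
  have alpha: "contract (\<lambda>f. S (f ! 0) * alpha ?K * f ! 1) F = alpha H"
  proof -
    have "contract (\<lambda>f. S (f ! 0) * alpha ?K * f ! 1) F = contract (\<lambda>t. S (t ! 0) * alpha H * t ! 1) (tone 2)"
      unfolding K alpha_form_tmult[OF G FT, symmetric] GF ..
    also have "\<dots> = alpha H"
      by (subst contract_tone2) (auto intro!: multilinear2I lin_intros simp: antipode_one)
    finally show ?thesis .
  qed
  have beta: "contract (\<lambda>g. g ! 0 * beta ?K * S (g ! 1)) G = beta H"
  proof -
    have "contract (\<lambda>g. g ! 0 * beta ?K * S (g ! 1)) G = contract (\<lambda>t. t ! 0 * beta H * S (t ! 1)) (tone 2)"
      unfolding K beta_form_tmult[OF GT F, symmetric] GF ..
    also have "\<dots> = beta H"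
      by (subst contract_tone2) (auto intro!: multilinear2I lin_intros simp: antipode_one)
    finally show ?thesis .
  qed
  have RK: "concentrated 2 {0} (rmatrix ?K)"
    unfolding K by (intro concentrated_tmult_even concentrated_swap F R G)
  let ?\<gamma>' = "contract (koszul 0 (alpha ?K)) (rmatrix ?K)"
  have gamma': "?\<gamma>' = contract (koszul 0 \<gamma>) G"
    unfolding K(2) koszul_tmult[OF concentrated_tmult_even[OF concentrated_swap[OF F] R] GT]
      koszul_tmult[OF concentrated_swap[OF F] RT] koszul_swap[OF FT] alpha ..
  have gamma: "contract (koszul 0 ?\<gamma>') F = \<gamma>"
  proof -
    have "contract (koszul 0 ?\<gamma>') F = contract (koszul 0 \<gamma>) (tone 2)"
      unfolding gamma' koszul_tmult[OF G FT, symmetric] GF ..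
    also have "\<dots> = \<gamma>"
      unfolding contract_tone2[OF multilinear_koszul]
      by (simp add: koszul_hom[OF grade_one grade_one] antipode_one parity_sign_simps)
    finally show ?thesis .
  qed
  let ?V = "insert_one 2 2 F \<odot>\<^bsub>3\<^esub> comult_at H 2 0 F \<odot>\<^bsub>3\<^esub> coassociator H"
  have V: "?V \<in> tensors 3"
    by (intro tmult_in_tensors contract_insert_one contract_comult_at FT WT) simp_all
  have VG: "?V \<odot>\<^bsub>3\<^esub> comult_at H 2 1 G \<in> tensors 3"
    by (intro tmult_in_tensors V contract_comult_at GT) simp
  have "u_operator ?K = contract (u_form ?\<gamma>' (beta ?K)) (?V \<odot>\<^bsub>3\<^esub> comult_at H 2 1 G \<odot>\<^bsub>3\<^esub> insert_one 2 0 G)"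
    unfolding u_operator_eq_u_form[OF RK K(1)] K(3) ..
  also have "\<dots> = contract (u_form ?\<gamma>' (beta H)) (?V \<odot>\<^bsub>3\<^esub> comult_at H 2 1 G)"
    by (simp only: u_form_right_insert[OF VG G] beta)
  also have "\<dots> = contract (u_form ?\<gamma>' (beta H)) ?V"
    by (rule u_form_right_comult[OF V G c1'])
  also have "\<dots> = contract (u_form \<gamma> (beta H)) (coassociator H)"
    by (rule u_form_left[OF F W c0 gamma gamma_comult])
  also have "\<dots> = u_operator H"
    by (rule u_operator_eq_u_form[OF R refl, symmetric])
  finally show ?thesis .
qed

end

theorem theorem4:
  fixes scale :: "'k::field \<Rightarrow> 'a::ring_1 \<Rightarrow> 'a"
    and \<A> :: "bit \<Rightarrow> 'a set"
    and H :: "('k, 'a) quasi_hopf_data"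
    and F :: "('k, 'a) tensor"
  assumes "quasi_triangular_quasi_hopf_superalgebra scale \<A> H"
    and "graded_algebra.twistor scale \<A> H F"
  shows "graded_algebra.u_operator scale \<A> (graded_algebra.twist scale \<A> F H)
       = graded_algebra.u_operator scale \<A> H"
proof -
  interpret quasi_triangular_quasi_hopf_superalgebra scale \<A> H by (rule assms(1))
  show ?thesis by (rule u_operator_twist[OF assms(2)])
qed

end
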